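(* Let $\lambda$ be an uncountable cardinal and $F$ a field of cardinality $\lambda$. Then there exists a $\lambda$-Gross space over $F$ of dimension $\lambda^+$.
   Context: For an infinite cardinal $\lambda$, a $\lambda$-Gross space over a field $F$ is an $F$-vector space $E$ with a symmetric bilinear form $\Phi:E\times E\to F$ such that every subspace $U\subseteq E$ with $\dim U\ge\lambda$ satisfies $\dim U^\perp<\dim E$, where $U^\perp=\{x\in E:\Phi(x,y)=0\ \forall y\in U\}$. $\lambda^+$ is the cardinal successor of $\lambda$. *)

theory Defs
  imports Complex_Main "HOL-Library.Poly_Mapping"
begin

unbundle cardinal_syntax

text \<open>
  The library's \<^const>\<open>vector_space.dim\<close> is a natural number and is 0 on
  infinite-dimensional spaces, so the dimension of a subspace is given here as a cardinal. Lemma \<open>card_of_basis\<close> below shows that the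
  choice of the basis is immaterial.
\<close>

definition cdim :: "('a::field \<Rightarrow> 'b::ab_group_add \<Rightarrow> 'b) \<Rightarrow> 'b set \<Rightarrow> 'b rel" where
  "cdim scale V = |SOME B. \<not> module.dependent scale B \<and> module.span scale B = V|"

definition bilinear_on :: "('a::field \<Rightarrow> 'b::ab_group_add \<Rightarrow> 'b) \<Rightarrow> 'b set \<Rightarrow> ('b \<Rightarrow> 'b \<Rightarrow> 'a) \<Rightarrow> bool" where
  "bilinear_on scale E \<Phi> \<longleftrightarrow>
    (\<forall>x\<in>E. \<forall>y\<in>E. \<forall>z\<in>E. \<Phi> (x + y) z = \<Phi> x z + \<Phi> y z \<and> \<Phi> z (x + y) = \<Phi> z x + \<Phi> z y) \<and>
    (\<forall>c. \<forall>x\<in>E. \<forall>y\<in>E. \<Phi> (scale c x) y = c * \<Phi> x y \<and> \<Phi> x (scale c y) = c * \<Phi> x y)"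

definition symmetric_on :: "'b set \<Rightarrow> ('b \<Rightarrow> 'b \<Rightarrow> 'a) \<Rightarrow> bool" where
  "symmetric_on E \<Phi> \<longleftrightarrow> (\<forall>x\<in>E. \<forall>y\<in>E. \<Phi> x y = \<Phi> y x)"

definition orth :: "'b set \<Rightarrow> ('b \<Rightarrow> 'b \<Rightarrow> 'a::zero) \<Rightarrow> 'b set \<Rightarrow> 'b set" where
  "orth E \<Phi> U = {x \<in> E. \<forall>y\<in>U. \<Phi> x y = 0}"

text \<open>
  The underlying vector space is the subspace \<open>E\<close> of the ambient type; the values of \<open>\<Phi>\<close>
  outside \<open>E\<close> are irrelevant. Cardinals are represented by cardinal orders; the definition is
  meant for infinite \<open>\<kappa>\<close>.
\<close>

definition gross_space ::
  "('a::field \<Rightarrow> 'b::ab_group_add \<Rightarrow> 'b) \<Rightarrow> 'c rel \<Rightarrow> 'b set \<Rightarrow> ('b \<Rightarrow> 'b \<Rightarrow> 'a) \<Rightarrow> bool" where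
  "gross_space scale \<kappa> E \<Phi> \<longleftrightarrow>
    module.subspace scale E \<and> bilinear_on scale E \<Phi> \<and> symmetric_on E \<Phi> \<and>
    (\<forall>U. module.subspace scale U \<and> U \<subseteq> E \<and> \<kappa> \<le>o cdim scale U \<longrightarrow>
      cdim scale (orth E \<Phi> U) <o cdim scale E)"

context vector_space
begin

lemma card_of_basis_ordLeq:
  assumes "independent B" "independent C" "span B = span C"
  shows "|C| \<le>o |B|"
proof (cases "finite B")
  case True
  have "C \<subseteq> span B"
    using assms(3) span_superset by auto
  then have "finite C \<and> card C \<le> card B"
    using independent_span_bound[OF True assms(2)] by blast
  then show ?thesis
    using True card_le_inj[of C B] card_of_ordLeq[of C B] by blast
next
  case False
  define supp where "supp b = {v. representation C b v \<noteq> 0}" for b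
  define S where "S = (\<Union>b\<in>B. supp b)"
  have fin: "finite (supp b)" for b
    unfolding supp_def by (rule finite_representation)
  have SC: "S \<subseteq> C"
    unfolding S_def supp_def using representation_ne_zero by blast
  have "b \<in> span S" if "b \<in> B" for b
  proof -
    have "b \<in> span C"
      using that assms(3) span_base by auto
    then have "(\<Sum>v\<in>supp b. scale (representation C b v) v) = b"
      unfolding supp_def using sum_nonzero_representation_eq[OF assms(2)] by blast
    moreover have "(\<Sum>v\<in>supp b. scale (representation C b v) v) \<in> span S"
      using that by (intro span_sum span_scale span_base) (auto simp: S_def)
    ultimately show ?thesis by simp
  qed
  then have "span B \<subseteq> span S"
    by (intro span_minimal) auto
  then have "C \<subseteq> span S"
    using assms(3) span_superset by blast
  have "C \<subseteq> S"
  proof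
    fix c assume c: "c \<in> C"
    show "c \<in> S"
    proof (rule ccontr)
      assume "c \<notin> S"
      then have "S \<subseteq> C - {c}" using SC by auto
      then have "c \<in> span (C - {c})"
        using \<open>C \<subseteq> span S\<close> c span_mono by blast
      then show False
        using assms(2) c dependent_def by blast
    qed
  qed
  then have "|C| \<le>o |S|" by (rule card_of_mono1)
  moreover have "|S| \<le>o |B|"
    unfolding S_def
  proof (rule card_of_UNION_ordLeq_infinite[OF False])
    show "\<forall>b\<in>B. |supp b| \<le>o |B|"
      using fin False by (auto intro!: ordLess_imp_ordLeq finite_ordLess_infinite card_of_well_order_on simp: Field_card_of)
  qed (rule card_of_mono1, rule subset_refl)
  ultimately show ?thesis by (rule ordLeq_transitive)
qed

lemma card_of_basis:
  assumes "independent B" "span B = V"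
  shows "|B| =o cdim scale V"
proof -
  let ?C = "SOME B. independent B \<and> span B = V"
  have "independent ?C \<and> span ?C = V"
    using assms by (intro someI[of "\<lambda>B. independent B \<and> span B = V" B]) simp
  then show ?thesis
    unfolding cdim_def using assms card_of_basis_ordLeq by (simp add: ordIso_iff_ordLeq)
qed

end

end

theory Submission
  imports Defs "HOL-Library.Countable_Set"
begin

text \<open>
  Write \<open>\<lambda>\<close> for the cardinality of the field. The space has a basis \<open>e\<^sub>\<alpha>\<close> (\<open>\<alpha> < \<lambda>\<^sup>+\<close>), and the
  entries \<open>\<Phi>(e\<^sub>\<alpha>, e\<^sub>\<beta>)\<close>, \<open>\<alpha> < \<beta>\<close>, are chosen recursively. A rank function
  \<open>\<rho> \<beta> : \<beta> \<rightarrow> \<lambda>\<close> with small initial segments orders \<open>\<beta>\<close>, and each entry avoids the subfield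
  generated by fewer than \<open>\<lambda>\<close> field elements and earlier entries; this subfield is not the whole
  field since \<open>\<lambda>\<close> is uncountable.

  Suppose that \<open>U\<close> and \<open>U\<^sup>\<bottom>\<close> are both too large. Then \<open>U\<^sup>\<bottom>\<close> contains vectors whose top indices
  \<open>b 0 < b 1 < \<dots>\<close> lie above the support of a subspace of \<open>U\<close> of dimension \<open>\<lambda>\<close>. If the indices
  and coefficients of these vectors have bounded ranks, then a dimension count gives a nonzero
  \<open>u \<in> U\<close> supported on indices of larger rank. The orthogonality relations of \<open>u\<close> with as many of
  the vectors as \<open>u\<close> has coordinates form a square linear system, and it is nonsingular because
  the leading entry of each row is generic over all the other entries.

  Bounded ranks come for free unless \<open>\<lambda>\<close> has countable cofinality. In that case the ranks are
  built from a transitive filtration of the ordinals below \<open>\<lambda>\<^sup>+\<close>. That every unbounded set contains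
  an infinite chain of bounded rank is proved, as for Shelah's scales in pcf theory, by guessing
  clubs of \<open>\<omega>\<^sub>3\<close>.
\<close>

section \<open>Well-ordered types of a given cardinality\<close>

lemma class_wellorder_of_rel:
  assumes "Well_order r" "Field r = UNIV"
  shows "class.wellorder (\<lambda>x y. (x, y) \<in> r) (\<lambda>x y. (x, y) \<in> r \<and> x \<noteq> y)"
proof -
  interpret wo_rel r
    using assms(1) by (simp add: wo_rel_def)
  have refl: "(x, x) \<in> r" for x
    using REFL assms(2) by (auto simp: refl_on_def)
  have anti: "x = y" if "(x, y) \<in> r" "(y, x) \<in> r" for x y
    using ANTISYM that by (auto simp: antisym_def)
  have trans: "(x, z) \<in> r" if "(x, y) \<in> r" "(y, z) \<in> r" for x y z
    using TRANS that by (meson transD)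
  have total: "(x, y) \<in> r \<or> (y, x) \<in> r" for x y
    using TOTALS assms(2) by auto
  show ?thesis
  proof
    fix P a
    assume step: "\<And>x. (\<And>y. (y, x) \<in> r \<and> y \<noteq> x \<Longrightarrow> P y) \<Longrightarrow> P x"
    have "wf (r - Id)"
      using WELL by (simp add: well_order_on_def)
    then show "P a"
      by (rule wf_induct_rule) (rule step, blast)
  qed (use refl anti trans total in blast)+
qed

text \<open>A copy of \<open>'a\<close>, so that the well-order does not clash with an order that
  \<open>'a\<close> may already carry. The order is that of the cardinal \<open>|UNIV|\<close>,
  hence proper initial segments have smaller cardinality than the type.\<close>

typedef 'a card_ord = "UNIV :: 'a set"
  by simp

lemma bij_Rep_card_ord: "bij Rep_card_ord"
  by (metis (no_types) Rep_card_ord_inject Abs_card_ord_inverse UNIV_I bijI injI surjI)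

lemma card_of_card_ord: "|UNIV :: 'a card_ord set| =o |UNIV :: 'a set|"
  using bij_Rep_card_ord card_of_ordIso by blast

instantiation card_ord :: (type) wellorder
begin

definition less_eq_card_ord :: "'a card_ord \<Rightarrow> 'a card_ord \<Rightarrow> bool" where
  "x \<le> y \<longleftrightarrow> (x, y) \<in> |UNIV :: 'a card_ord set|"

definition less_card_ord :: "'a card_ord \<Rightarrow> 'a card_ord \<Rightarrow> bool" where
  "x < y \<longleftrightarrow> (x, y) \<in> |UNIV :: 'a card_ord set| \<and> x \<noteq> y"

instance
proof -
  have "class.wellorder ((\<le>) :: 'a card_ord \<Rightarrow> _) (<)"
    unfolding less_eq_card_ord_def less_card_ord_def
    by (rule class_wellorder_of_rel[OF card_of_Well_order Field_card_of])
  then show "OFCLASS('a card_ord, wellorder_class)"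
    by (rule wellorder.intro_of_class)
qed

end

text \<open>With this order \<open>'f suc\<close> serves as the set of ordinals below lambda^+, and
  iterating from \<open>nat\<close> yields omega_1, omega_2 and omega_3.\<close>

instantiation suc :: (type) wellorder
begin

definition less_eq_suc :: "'a suc \<Rightarrow> 'a suc \<Rightarrow> bool" where
  "x \<le> y \<longleftrightarrow> (x, y) \<in> card_suc |UNIV :: 'a set|"

definition less_suc :: "'a suc \<Rightarrow> 'a suc \<Rightarrow> bool" where
  "x < y \<longleftrightarrow> (x, y) \<in> card_suc |UNIV :: 'a set| \<and> x \<noteq> y"

instance
proof -
  have "Well_order (card_suc |UNIV :: 'a set| )"
    using Card_order_card_suc card_of_card_order_on card_order_on_well_order_on by blast
  then have "class.wellorder ((\<le>) :: 'a suc \<Rightarrow> _) (<)"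
    using class_wellorder_of_rel[of "card_suc |UNIV :: 'a set|"]
    unfolding less_eq_suc_def less_suc_def
    by (simp add: Field_card_suc)
  then show "OFCLASS('a suc, wellorder_class)"
    by (rule wellorder.intro_of_class)
qed

end


lemma card_of_lessThan_card_ord: "|{..<x :: 'a card_ord}| <o |UNIV :: 'a set|"
proof -
  have "{..<x} = underS |UNIV| x"
    by (auto simp: underS_def less_card_ord_def)
  moreover have "|underS |UNIV| x| <o |UNIV :: 'a card_ord set|"
    using card_of_underS[OF card_of_Card_order, of x UNIV] by (simp add: Field_card_of)
  ultimately show ?thesis
    using card_of_card_ord ordLess_ordIso_trans by fastforce
qed

lemma card_of_suc: "|UNIV :: 'a suc set| =o cardSuc |UNIV :: 'a set|"
proof -
  have "|Field (card_suc |UNIV :: 'a set| )| =o card_suc |UNIV :: 'a set|"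
    using Card_order_card_suc[OF card_of_card_order_on] card_of_Field_ordIso by blast
  then have "|UNIV :: 'a suc set| =o card_suc |UNIV :: 'a set|"
    by (simp add: Field_card_suc)
  then show ?thesis
    using cardSuc_ordIso_card_suc[OF card_of_card_order_on] ordIso_symmetric ordIso_transitive
    by blast
qed

lemma card_of_suc_greater: "|UNIV :: 'a set| <o |UNIV :: 'a suc set|"
  using cardSuc_greater[OF card_of_Card_order] card_of_suc ordIso_symmetric ordLess_ordIso_trans
  by blast

lemma card_of_less_suc_iff: "|A| <o |UNIV :: 'a suc set| \<longleftrightarrow> |A| \<le>o |UNIV :: 'a set|"
proof -
  have "|A| <o |UNIV :: 'a suc set| \<longleftrightarrow> |A| <o cardSuc |UNIV :: 'a set|"
    by (rule iffI; erule ordLess_ordIso_trans; rule card_of_suc ordIso_symmetric[OF card_of_suc])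
  also have "\<dots> \<longleftrightarrow> |A| \<le>o |UNIV :: 'a set|"
    by (rule cardSuc_ordLeq_ordLess[OF card_of_Card_order card_of_Card_order])
  finally show ?thesis .
qed

lemma lessThan_suc_eq: "{..<x :: 'a suc} = underS (card_suc |UNIV :: 'a set| ) x"
  by (rule set_eqI) (simp add: underS_def less_suc_def conj_commute)

lemma card_of_lessThan_suc: "|{..<x :: 'a suc}| \<le>o |UNIV :: 'a set|"
proof -
  have "|underS (card_suc |UNIV :: 'a set| ) x| <o card_suc |UNIV :: 'a set|"
    by (rule card_of_underS[OF Card_order_card_suc[OF card_of_card_order_on]])
      (simp add: Field_card_suc)
  then have "|underS (card_suc |UNIV :: 'a set| ) x| <o cardSuc |UNIV :: 'a set|"
    by (rule ordLess_ordIso_trans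
        [OF _ ordIso_symmetric[OF cardSuc_ordIso_card_suc[OF card_of_card_order_on]]])
  then show ?thesis
    unfolding lessThan_suc_eq
    by (rule cardSuc_ordLeq_ordLess[OF card_of_Card_order card_of_Card_order, THEN iffD1])
qed

lemma card_of_Un_ordLeq_infinite:
  assumes "infinite C" "|A| \<le>o |C|" "|B| \<le>o |C|"
  shows "|A \<union> B| \<le>o |C|"
  using assms
  by (intro card_of_Un_ordLeq_infinite_Field[OF _ _ _ card_of_Card_order]) (auto simp: Field_card_of)

lemma card_of_finite_ordLeq_infinite: "infinite C \<Longrightarrow> finite A \<Longrightarrow> |A| \<le>o |C|"
  by (meson card_of_ordLeq_finite ordLeq_total card_of_Well_order)

lemma card_of_atMost_suc:
  assumes "infinite (UNIV :: 'a set)"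
  shows "|{..x :: 'a suc}| \<le>o |UNIV :: 'a set|"
proof -
  have "{..x} = {..<x} \<union> {x}"
    by auto
  then show ?thesis
    using card_of_Un_ordLeq_infinite[OF assms card_of_lessThan_suc[of x]]
      card_of_finite_ordLeq_infinite[OF assms, of "{x}"] by (metis finite.emptyI finite.insertI)
qed

text \<open>Regularity of a successor cardinal: were the set unbounded, the whole type would be a
  union of too few initial segments, each of them too small.\<close>

lemma bounded_suc:
  assumes "infinite (UNIV :: 'a set)" "|Y| \<le>o |UNIV :: 'a set|"
  shows "\<exists>b :: 'a suc. \<forall>y\<in>Y. y < b"
proof (rule ccontr)
  assume "\<not> ?thesis"
  then have "(\<Union>y\<in>Y. {..y}) = UNIV"
    by (auto simp: not_less)
  moreover have "|\<Union>y\<in>Y. {..y}| \<le>o |UNIV :: 'a set|"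
    using assms card_of_atMost_suc by (intro card_of_UNION_ordLeq_infinite) auto
  ultimately show False
    using card_of_suc_greater not_ordLess_ordLeq by metis
qed

lemma infinite_suc: "infinite (UNIV :: 'a set) \<Longrightarrow> infinite (UNIV :: 'a suc set)"
  using card_of_suc_greater card_of_ordLeq_infinite ordLess_imp_ordLeq by blast

section \<open>Club guessing\<close>

text \<open>Greedy enumeration. As long as only finitely many members of \<open>Z\<close> lie at or
  below the current one, there is a next member, and taking the least one preserves this
  invariant.\<close>

lemma infinite_imp_strict_mono_seq:
  fixes Z :: "'a::wellorder set"
  assumes "infinite Z"
  shows "\<exists>s :: nat \<Rightarrow> 'a. strict_mono s \<and> range s \<subseteq> Z"
proof -
  have least: "\<exists>z\<in>Z. x < z \<and> finite {y\<in>Z. y \<le> z}" if "finite {y\<in>Z. y \<le> x}" for x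
  proof -
    have "infinite {y\<in>Z. x < y}"
    proof
      assume "finite {y\<in>Z. x < y}"
      moreover have "Z = {y\<in>Z. y \<le> x} \<union> {y\<in>Z. x < y}"
        by auto
      ultimately show False
        using that assms by (metis finite_Un)
    qed
    then have "\<exists>y. y \<in> Z \<and> x < y"
      using not_finite_existsD by blast
    then obtain z where z: "z \<in> Z \<and> x < z" "\<And>y. y < z \<Longrightarrow> \<not> (y \<in> Z \<and> x < y)"
      using exists_least_iff[of "\<lambda>y. y \<in> Z \<and> x < y"] by blast
    have "{y\<in>Z. y \<le> z} \<subseteq> insert z {y\<in>Z. y \<le> x}"
      using z(2) by (auto simp: not_less order_le_less)
    then have "finite {y\<in>Z. y \<le> z}"
      using that by (meson finite.insertI finite_subset)
    then show ?thesis
      using z by auto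
  qed
  obtain z0 where z0: "z0 \<in> Z" "\<And>y. y < z0 \<Longrightarrow> y \<notin> Z"
    using exists_least_iff[of "\<lambda>y. y \<in> Z"] assms by (metis finite.emptyI ex_in_conv)
  have "{y\<in>Z. y \<le> z0} \<subseteq> {z0}"
    using z0(2) by (auto simp: order_le_less)
  then have "\<exists>z. z \<in> Z \<and> finite {y\<in>Z. y \<le> z}"
    using z0(1) by (meson finite.emptyI finite.insertI finite_subset)
  then have "\<exists>s :: nat \<Rightarrow> 'a. \<forall>n. (s n \<in> Z \<and> finite {y\<in>Z. y \<le> s n}) \<and> s n < s (Suc n)"
    by (rule dependent_nat_choice) (use least in blast)
  then obtain s :: "nat \<Rightarrow> 'a" where "\<forall>n. (s n \<in> Z \<and> finite {y\<in>Z. y \<le> s n}) \<and> s n < s (Suc n)"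
    by blast
  then show ?thesis
    by (auto intro!: exI[of _ s] simp: strict_mono_Suc_iff)
qed

lemma no_strictly_decreasing_seq:
  fixes s :: "nat \<Rightarrow> 'a::wellorder"
  shows "\<not> (\<forall>m n. m < n \<longrightarrow> s n < s m)"
proof
  assume "\<forall>m n. m < n \<longrightarrow> s n < s m"
  then have "(s (Suc k), s k) \<in> {(x, y). x < y}" for k
    by simp
  then show False
    using wf_no_infinite_down_chainE[OF wf] by blast
qed

lemma countable_imp_card_of_nat:
  assumes "countable Y"
  shows "|Y| \<le>o |UNIV :: nat set|"
proof (cases "Y = {}")
  case False
  have "|range (from_nat_into Y)| \<le>o |UNIV :: nat set|"
    by (rule card_of_image)
  then show ?thesis
    by (simp add: range_from_nat_into[OF False assms])
qed (simp add: card_of_empty)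

text \<open>Every club of a regular uncountable cardinal contains a set of the form \<open>cl g\<close>.\<close>

definition cl :: "('t::wellorder \<Rightarrow> 't) \<Rightarrow> 't set" where
  "cl g = {i. (\<exists>j. j < i) \<and> (\<forall>j<i. g j < i)}"

text \<open>The supremum of the members of \<open>cl g\<close> up to \<open>x\<close>. If there are
  none, the value is the least element of the type, which is not in \<open>cl g\<close>.\<close>

definition prj :: "('t::wellorder \<Rightarrow> 't) \<Rightarrow> 't \<Rightarrow> 't" where
  "prj g x = (LEAST u. \<forall>y\<in>cl g. y \<le> x \<longrightarrow> y \<le> u)"

lemma cl_antimono: "(\<And>j. g j \<le> h j) \<Longrightarrow> cl h \<subseteq> cl g"
  unfolding cl_def by (auto intro: order_le_less_trans)

lemma prj_le: "prj g x \<le> x"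
  unfolding prj_def by (rule Least_le) simp

lemma le_prj: "y \<in> cl g \<Longrightarrow> y \<le> x \<Longrightarrow> y \<le> prj g x"
  unfolding prj_def by (rule LeastI2[of _ x]) simp_all

text \<open>Clubs are closed: any \<open>j\<close> below the supremum lies below a member
  \<open>z\<close> of \<open>cl g\<close>, so that \<open>g j < z\<close>.\<close>

lemma prj_in_cl:
  assumes "y \<in> cl g" "y \<le> x"
  shows "prj g x \<in> cl g"
  unfolding cl_def
proof (intro CollectI conjI allI impI)
  show "\<exists>j. j < prj g x"
    using le_prj[OF assms] assms(1) unfolding cl_def by (auto intro: order_less_le_trans)
  fix j
  assume j: "j < prj g x"
  have "\<exists>z\<in>cl g. z \<le> x \<and> j < z"
  proof (rule ccontr)
    assume "\<not> ?thesis"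
    then have "\<forall>z\<in>cl g. z \<le> x \<longrightarrow> z \<le> j"
      by (auto simp: not_less)
    then have "prj g x \<le> j"
      unfolding prj_def by (rule Least_le)
    then show False
      using j by simp
  qed
  then obtain z where z: "z \<in> cl g" "z \<le> x" "j < z"
    by blast
  then have "g j < z"
    by (simp add: cl_def)
  then show "g j < prj g x"
    using le_prj[OF z(1,2)] by simp
qed

text \<open>Suprema are expressed throughout as least strict upper bounds; this describes such a
  bound by its initial segment.\<close>

lemma less_Least_strict_ub_iff:
  fixes q :: "'b \<Rightarrow> 'a::wellorder"
  assumes "\<exists>b. \<forall>y\<in>Y. q y < b"
  shows "x < (LEAST b. \<forall>y\<in>Y. q y < b) \<longleftrightarrow> (\<exists>y\<in>Y. x \<le> q y)"
proof
  assume "\<exists>y\<in>Y. x \<le> q y"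
  moreover have "\<forall>y\<in>Y. q y < (LEAST b. \<forall>y\<in>Y. q y < b)"
    using assms by (rule LeastI_ex)
  ultimately show "x < (LEAST b. \<forall>y\<in>Y. q y < b)"
    using order_le_less_trans by blast
next
  assume less: "x < (LEAST b. \<forall>y\<in>Y. q y < b)"
  show "\<exists>y\<in>Y. x \<le> q y"
  proof (rule ccontr)
    assume "\<not> ?thesis"
    then have "(LEAST b. \<forall>y\<in>Y. q y < b) \<le> x"
      by (intro Least_le) (auto simp: not_le)
    then show False
      using less by simp
  qed
qed

lemma Least_strict_ub_greater:
  fixes q :: "'b \<Rightarrow> 'a::wellorder"
  assumes "\<exists>b. \<forall>y\<in>Y. q y < b" "y \<in> Y"
  shows "q y < (LEAST b. \<forall>y\<in>Y. q y < b)"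
  using less_Least_strict_ub_iff[OF assms(1), of "q y"] assms(2) by blast

text \<open>Iterate omega times, starting at \<open>x\<close>, a step that passes all values of
  \<open>g\<close> on the segment reached so far. The supremum of the iterates is closed under
  \<open>g\<close>.\<close>

lemma cl_unbounded:
  fixes g :: "'t::wellorder \<Rightarrow> 't"
  assumes seg: "\<And>x :: 't. \<exists>b. \<forall>j\<le>x. g j < b"
    and ctbl: "\<And>Y :: 't set. countable Y \<Longrightarrow> \<exists>b. \<forall>y\<in>Y. y < b"
  shows "\<exists>i\<in>cl g. x < i"
proof -
  have "\<exists>b. y < b \<and> (\<forall>j\<le>y. g j < b)" for y
  proof -
    obtain b where "\<forall>j\<le>y. g j < b"
      using seg by blast
    moreover obtain b' where "y < b'" "b < b'"
      using ctbl[of "{y, b}"] by auto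
    ultimately show ?thesis
      by (meson order_less_trans)
  qed
  then obtain nx where nx: "\<And>y. y < nx y" "\<And>y j. j \<le> y \<Longrightarrow> g j < nx y"
    by metis
  define q where "q n = (nx ^^ n) x" for n
  define i where "i = (LEAST b. \<forall>n\<in>UNIV. q n < b)"
  have ub: "\<exists>b. \<forall>n\<in>UNIV. q n < b"
    using ctbl[of "range q"] by auto
  have "x < i"
    using Least_strict_ub_greater[OF ub, of 0] by (simp add: i_def q_def)
  moreover have "g j < i" if j: "j < i" for j
  proof -
    obtain n where "j \<le> q n"
      using j[unfolded i_def less_Least_strict_ub_iff[OF ub]] by blast
    then have "g j < q (Suc n)"
      using nx(2) by (simp add: q_def)
    then show ?thesis
      using Least_strict_ub_greater[OF ub, of "Suc n"] by (simp add: i_def)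
  qed
  ultimately show ?thesis
    unfolding cl_def by blast
qed

text \<open>
  If guessing fails, iterate the failure: at stage \<open>\<zeta>\<close>, project a ladder \<open>A \<alpha>\<close> to \<open>cl (h \<zeta>)\<close> and take
  a \<open>g\<close> whose club misses the projections. Some element of the ladder then has a projection that
  moves down at infinitely many stages.
\<close>

lemma club_guessing:
  fixes K :: "'k::wellorder itself" and M :: "'m::wellorder itself"
  assumes ctblK: "\<And>Y :: 'k set. countable Y \<Longrightarrow> \<exists>b. \<forall>y\<in>Y. y < b"
    and KM: "|UNIV :: 'k set| <o |UNIV :: 'm set|"
    and bddT: "\<And>Y :: 't::wellorder set. |Y| \<le>o |UNIV :: 'm set| \<Longrightarrow> \<exists>b. \<forall>y\<in>Y. y < b"
    and segT: "\<And>x :: 't. |{..x}| \<le>o |UNIV :: 'm set|"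
  shows "\<exists>C :: 't \<Rightarrow> 't set. \<forall>g. \<exists>\<alpha>. uncountable (C \<alpha>) \<and> C \<alpha> \<subseteq> cl g"
proof (rule ccontr)
  assume neg: "\<not> ?thesis"
  have ctr: "\<exists>g. \<forall>\<alpha>. uncountable (C \<alpha>) \<longrightarrow> \<not> C \<alpha> \<subseteq> cl g" for C :: "'t \<Rightarrow> 't set"
    using neg[unfolded not_ex not_all, THEN spec, of C] by (simp only: de_Morgan_conj imp_conv_disj not_not)
  have infK: "infinite (UNIV :: 'k set)"
    using ctblK[of UNIV] by (metis UNIV_I countable_finite less_irrefl)
  have KM': "|UNIV :: 'k set| \<le>o |UNIV :: 'm set|"
    using KM ordLess_imp_ordLeq by blast
  have bdd_img: "\<exists>b. \<forall>y\<in>Y. f y < b" if "|Y| \<le>o |UNIV :: 'm set|" for Y :: "'y set" and f :: "'y \<Rightarrow> 't"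
  proof -
    have "\<exists>b. \<forall>y\<in>f ` Y. y < b"
      by (rule bddT, rule ordLeq_transitive[OF card_of_image that])
    then show ?thesis
      by blast
  qed
  have bdd_segM: "\<exists>b. \<forall>\<zeta>\<in>Y. f \<zeta> < b" for f :: "'m \<Rightarrow> 't" and Y
    by (rule bdd_img, rule card_of_mono1) simp
  have bdd_segK: "\<exists>b. \<forall>\<nu>\<in>Y. f \<nu> < b" for f :: "'k \<Rightarrow> 't" and Y
    by (rule bdd_img, rule ordLeq_transitive[OF card_of_mono1 KM']) simp
  have bdd_segT: "\<exists>b. \<forall>j\<le>x. f j < b" for f :: "'t \<Rightarrow> 't" and x
    using bdd_img[OF segT[of x], of f] by auto
  have bdd_ctbl: "\<exists>b. \<forall>y\<in>Y. y < b" if "countable Y" for Y :: "'t set"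
  proof (rule bddT, rule ordLeq_transitive[OF _ KM'])
    have natK: "|UNIV :: nat set| \<le>o |UNIV :: 'k set|"
      using infK infinite_iff_card_of_nat by blast
    show "|Y| \<le>o |UNIV :: 'k set|"
      by (rule ordLeq_transitive[OF countable_imp_card_of_nat[OF that] natK])
  qed
  \<comment> \<open>\<open>good\<close> describes a cofinal subset of \<alpha> with at most
    \<open>'k\<close> many elements; such a set, where one exists, is the ladder.\<close>
  define good where "good \<alpha> B \<longleftrightarrow> B \<subseteq> {..<\<alpha>} \<and> |B| \<le>o |UNIV :: 'k set| \<and> (\<forall>x<\<alpha>. \<exists>a\<in>B. x \<le> a)"
    for \<alpha> :: 't and B
  define A where "A \<alpha> = (SOME B. good \<alpha> B)" for \<alpha>
  define CC where "CC h \<alpha> = prj h ` {x \<in> A \<alpha>. \<exists>y\<in>cl h. y \<le> x}" for h \<alpha>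
  \<comment> \<open>The pointwise strict supremum of the functions chosen at the stages in
    \<open>Z\<close>; its club is contained in the clubs of all of them.\<close>
  define hs where "hs f Z j = (LEAST b. \<forall>\<zeta>\<in>Z. f \<zeta> j < b)" for f :: "'m \<Rightarrow> 't \<Rightarrow> 't" and Z j
  have "\<exists>G :: 'm \<Rightarrow> 't \<Rightarrow> 't. \<forall>\<zeta>. \<forall>\<alpha>. uncountable (CC (hs G {..<\<zeta>}) \<alpha>) \<longrightarrow>
      \<not> CC (hs G {..<\<zeta>}) \<alpha> \<subseteq> cl (G \<zeta>)"
  proof (rule dependent_wf_choice[OF wf])
    fix f g :: "'m \<Rightarrow> 't \<Rightarrow> 't" and \<zeta> r
    assume "\<And>z. (z, \<zeta>) \<in> {(x, y). x < y} \<Longrightarrow> f z = g z"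
    then have "hs f {..<\<zeta>} = hs g {..<\<zeta>}"
      by (auto simp: hs_def fun_eq_iff)
    then show "(\<forall>\<alpha>. uncountable (CC (hs f {..<\<zeta>}) \<alpha>) \<longrightarrow> \<not> CC (hs f {..<\<zeta>}) \<alpha> \<subseteq> cl r) =
        (\<forall>\<alpha>. uncountable (CC (hs g {..<\<zeta>}) \<alpha>) \<longrightarrow> \<not> CC (hs g {..<\<zeta>}) \<alpha> \<subseteq> cl r)"
      by simp
  qed (rule ctr)
  then obtain G :: "'m \<Rightarrow> 't \<Rightarrow> 't" where
    G: "\<And>\<zeta> \<alpha>. uncountable (CC (hs G {..<\<zeta>}) \<alpha>) \<Longrightarrow> \<not> CC (hs G {..<\<zeta>}) \<alpha> \<subseteq> cl (G \<zeta>)"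
    by blast
  define h where "h \<zeta> = hs G {..<\<zeta>}" for \<zeta>
  have hs_greater: "G \<zeta> j < hs G Z j" if "\<zeta> \<in> Z" for \<zeta> j Z
    unfolding hs_def using Least_strict_ub_greater[OF bdd_segM that, of "\<lambda>\<zeta>. G \<zeta> j"] .
  have hs_mono: "hs G Z j \<le> hs G Z' j" if "Z \<subseteq> Z'" for Z Z' j
    unfolding hs_def
  proof (rule Least_le, intro ballI)
    fix \<zeta>
    assume "\<zeta> \<in> Z"
    then show "G \<zeta> j < (LEAST b. \<forall>\<zeta>\<in>Z'. G \<zeta> j < b)"
      using hs_greater that unfolding hs_def by blast
  qed
  have cl_top: "cl (hs G UNIV) \<subseteq> cl (h \<zeta>)" for \<zeta>
    unfolding h_def by (rule cl_antimono, rule hs_mono) simp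
  have cl_h_G: "cl (h \<zeta>') \<subseteq> cl (G \<zeta>)" if "\<zeta> < \<zeta>'" for \<zeta> \<zeta>'
    unfolding h_def using that hs_greater by (intro cl_antimono less_imp_le) auto
  have cl_h_h: "cl (h \<zeta>') \<subseteq> cl (h \<zeta>)" if "\<zeta> < \<zeta>'" for \<zeta> \<zeta>'
    unfolding h_def using that by (intro cl_antimono hs_mono) auto
  \<comment> \<open>The points common to the clubs of all stages are unbounded. The supremum
    \<alpha> of an increasing \<open>'k\<close>-sequence of them is the place where the failures at
    all stages come into conflict.\<close>
  have "\<exists>q :: 'k \<Rightarrow> 't. \<forall>\<nu>. q \<nu> \<in> cl (hs G UNIV) \<and> (\<forall>\<nu>'<\<nu>. q \<nu>' < q \<nu>)"
  proof (rule dependent_wf_choice[OF wf])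
    fix q :: "'k \<Rightarrow> 't" and \<nu>
    obtain b where "\<forall>\<nu>'\<in>{..<\<nu>}. q \<nu>' < b"
      using bdd_segK by blast
    moreover obtain v where "v \<in> cl (hs G UNIV)" "b < v"
      using cl_unbounded[OF bdd_segT bdd_ctbl] by blast
    ultimately show "\<exists>v. v \<in> cl (hs G UNIV) \<and> (\<forall>\<nu>'<\<nu>. q \<nu>' < v)"
      by (meson lessThan_iff order_less_trans)
  qed auto
  then obtain q :: "'k \<Rightarrow> 't" where
    q: "\<And>\<nu>. q \<nu> \<in> cl (hs G UNIV)" "\<And>\<nu> \<nu>'. \<nu>' < \<nu> \<Longrightarrow> q \<nu>' < q \<nu>"
    by blast
  define \<alpha> where "\<alpha> = (LEAST b. \<forall>\<nu>\<in>UNIV. q \<nu> < b)"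
  have less_\<alpha>: "x < \<alpha> \<longleftrightarrow> (\<exists>\<nu>. x \<le> q \<nu>)" for x
    using less_Least_strict_ub_iff[OF bdd_segK, of x UNIV q] unfolding \<alpha>_def by simp
  have "good \<alpha> (range q)"
    unfolding good_def using less_\<alpha> by (auto intro: card_of_image)
  then have "good \<alpha> (A \<alpha>)"
    unfolding A_def by (rule someI)
  then have A: "A \<alpha> \<subseteq> {..<\<alpha>}" "|A \<alpha>| \<le>o |UNIV :: 'k set|" "\<And>x. x < \<alpha> \<Longrightarrow> \<exists>a\<in>A \<alpha>. x \<le> a"
    unfolding good_def by blast+
  have CC_cofinal: "\<exists>y\<in>CC (h \<zeta>) \<alpha>. q \<nu> \<le> y" for \<zeta> \<nu>
  proof -
    obtain a where a: "a \<in> A \<alpha>" "q \<nu> \<le> a"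
      using A(3)[of "q \<nu>"] less_\<alpha> by blast
    have "q \<nu> \<in> cl (h \<zeta>)"
      using q(1) cl_top by blast
    then show ?thesis
      using a le_prj unfolding CC_def by blast
  qed
  \<comment> \<open>The projected ladder stays cofinal in \<alpha>, because each
    \<open>q \<nu>\<close> belongs to the current club and so survives below the projection of a
    larger point. A countable set cannot be cofinal, as \<open>'k\<close> bounds its countable
    subsets.\<close>
  have unc: "uncountable (CC (h \<zeta>) \<alpha>)" for \<zeta>
  proof
    assume ctbl: "countable (CC (h \<zeta>) \<alpha>)"
    have "CC (h \<zeta>) \<alpha> \<subseteq> {..<\<alpha>}"
      unfolding CC_def using A(1) prj_le[of "h \<zeta>"] order_le_less_trans by blast
    then have "\<forall>y\<in>CC (h \<zeta>) \<alpha>. \<exists>\<nu>. y \<le> q \<nu>"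
      using less_\<alpha> by auto
    then obtain n where n: "\<And>y. y \<in> CC (h \<zeta>) \<alpha> \<Longrightarrow> y \<le> q (n y)"
      by metis
    obtain \<nu> where \<nu>: "\<And>y. y \<in> CC (h \<zeta>) \<alpha> \<Longrightarrow> n y < \<nu>"
      using ctblK[of "n ` CC (h \<zeta>) \<alpha>"] ctbl by auto
    obtain y where "y \<in> CC (h \<zeta>) \<alpha>" "q \<nu> \<le> y"
      using CC_cofinal by blast
    then show False
      using n[of y] q(2)[OF \<nu>[of y]] by simp
  qed
  have "\<exists>x\<in>A \<alpha>. (\<exists>y\<in>cl (h \<zeta>). y \<le> x) \<and> prj (h \<zeta>) x \<notin> cl (G \<zeta>)" for \<zeta>
    using G[folded h_def, OF unc, of \<zeta>] unfolding CC_def by blast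
  then obtain x where x: "\<And>\<zeta>. x \<zeta> \<in> A \<alpha>" "\<And>\<zeta>. \<exists>y\<in>cl (h \<zeta>). y \<le> x \<zeta>"
    "\<And>\<zeta>. prj (h \<zeta>) (x \<zeta>) \<notin> cl (G \<zeta>)"
    by metis
  \<comment> \<open>Pigeonhole: there are more stages than elements of the ladder, since
    \<open>'k\<close> is smaller than \<open>'m\<close>.\<close>
  have "\<exists>a\<in>A \<alpha>. infinite {\<zeta>. x \<zeta> = a}"
  proof (rule ccontr)
    assume "\<not> ?thesis"
    then have "\<forall>a\<in>A \<alpha>. |{\<zeta>. x \<zeta> = a}| \<le>o |UNIV :: 'k set|"
      by (auto intro: card_of_finite_ordLeq_infinite[OF infK])
    then have "|\<Union>a\<in>A \<alpha>. {\<zeta>. x \<zeta> = a}| \<le>o |UNIV :: 'k set|"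
      by (rule card_of_UNION_ordLeq_infinite[OF infK A(2)])
    moreover have "(\<Union>a\<in>A \<alpha>. {\<zeta>. x \<zeta> = a}) = UNIV"
      using x(1) by auto
    ultimately show False
      using not_ordLess_ordLeq[OF KM] by simp
  qed
  then obtain a where a: "infinite {\<zeta>. x \<zeta> = a}"
    by blast
  obtain s :: "nat \<Rightarrow> 'm" where s: "strict_mono s" "range s \<subseteq> {\<zeta>. x \<zeta> = a}"
    using infinite_imp_strict_mono_seq[OF a] by blast
  have xs: "x (s n) = a" for n
    using s(2) by auto
  \<comment> \<open>The clubs shrink, so projections can only move down. They cannot stay put,
    because the projection at stage \<open>s m\<close> avoids \<open>cl (G (s m))\<close>, which
    contains every later club.\<close>
  have "prj (h (s n)) a < prj (h (s m)) a" if "m < n" for m n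
  proof -
    have mn: "s m < s n"
      using s(1) that by (simp add: strict_mono_def)
    obtain y where y: "y \<in> cl (h (s n))" "y \<le> a"
      using x(2)[of "s n"] xs by auto
    have in_cl: "prj (h (s n)) a \<in> cl (h (s n))"
      using prj_in_cl y by blast
    then have "prj (h (s n)) a \<noteq> prj (h (s m)) a"
      using x(3)[of "s m"] xs cl_h_G[OF mn] by auto
    moreover have "prj (h (s n)) a \<le> prj (h (s m)) a"
      using in_cl cl_h_h[OF mn] prj_le le_prj by blast
    ultimately show ?thesis
      by simp
  qed
  then show False
    using no_strictly_decreasing_seq[of "\<lambda>n. prj (h (s n)) a"] by blast
qed

section \<open>A transitive filtration below each index\<close>

definition is_lim :: "'t::wellorder \<Rightarrow> bool" where
  "is_lim i \<longleftrightarrow> (\<exists>j. j < i) \<and> (\<forall>j<i. \<exists>k. j < k \<and> k < i)"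

definition continuous_seq :: "('t::wellorder \<Rightarrow> 'i::wellorder) \<Rightarrow> bool" where
  "continuous_seq e \<longleftrightarrow> strict_mono e \<and> (\<forall>i. is_lim i \<longrightarrow> e i = (LEAST b. \<forall>j\<in>{..<i}. e j < b))"

text \<open>States through the initial segment of \<delta> that \<delta> is the least strict upper
  bound of the range.\<close>

definition has_sup :: "('t::wellorder \<Rightarrow> 'i::wellorder) \<Rightarrow> 'i \<Rightarrow> bool" where
  "has_sup e \<delta> \<longleftrightarrow> (\<forall>x. x < \<delta> \<longleftrightarrow> (\<exists>i. x \<le> e i))"

text \<open>Both sequences are cofinal in \<delta>, so each overtakes the other. At a limit index
  closed under the overtaking function \<open>g\<close> they interleave, and continuity gives them
  the same supremum there.\<close>

lemma cl_coincide:
  fixes \<xi> e :: "'t::wellorder \<Rightarrow> 'i::wellorder"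
  assumes nomax: "\<And>x :: 't. \<exists>y. x < y"
    and \<xi>: "continuous_seq \<xi>" "has_sup \<xi> \<delta>" and e: "continuous_seq e" "has_sup e \<delta>"
  shows "\<exists>g. \<forall>i\<in>cl g. \<xi> i = e i"
proof -
  have "\<exists>y. j < y \<and> (\<exists>i<y. e j \<le> \<xi> i) \<and> (\<exists>i<y. \<xi> j \<le> e i)" for j
  proof -
    obtain i where i: "e j \<le> \<xi> i"
      using \<xi>(2) e(2) unfolding has_sup_def by blast
    obtain i' where i': "\<xi> j \<le> e i'"
      using \<xi>(2) e(2) unfolding has_sup_def by blast
    obtain y where "max j (max i i') < y"
      using nomax by blast
    then show ?thesis
      using i i' by auto
  qed
  then obtain g where g: "\<And>j. j < g j" "\<And>j. \<exists>i<g j. e j \<le> \<xi> i" "\<And>j. \<exists>i<g j. \<xi> j \<le> e i"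
    by metis
  have "\<xi> i = e i" if i: "i \<in> cl g" for i
  proof -
    have gi: "g j < i" if "j < i" for j
      using i that by (simp add: cl_def)
    have "is_lim i"
      using i g(1) unfolding cl_def is_lim_def by blast
    moreover have "(\<forall>j\<in>{..<i}. \<xi> j < b) \<longleftrightarrow> (\<forall>j\<in>{..<i}. e j < b)" for b
    proof safe
      fix j assume "\<forall>j\<in>{..<i}. \<xi> j < b" "j < i"
      then show "e j < b"
        using g(2)[of j] gi[of j] by (meson lessThan_iff order_le_less_trans order_less_trans)
    next
      fix j assume "\<forall>j\<in>{..<i}. e j < b" "j < i"
      then show "\<xi> j < b"
        using g(3)[of j] gi[of j] by (meson lessThan_iff order_le_less_trans order_less_trans)
    qed
    ultimately show ?thesis
      using \<xi>(1) e(1) unfolding continuous_seq_def by simp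
  qed
  then show ?thesis
    by blast
qed

text \<open>In the application \<open>'l\<close> has cardinality lambda of countable cofinality and
  is exhausted by the smaller sets \<open>L n\<close>, \<open>'t\<close> is omega_3 with a guessing
  sequence \<open>C\<close>, and \<open>'i\<close> is lambda^+.\<close>

locale filtration_setup =
  fixes L :: "nat \<Rightarrow> 'l::wellorder set" and C :: "'t::wellorder \<Rightarrow> 't set" and I :: "'i::wellorder itself"
  assumes mono_L: "m \<le> n \<Longrightarrow> L m \<subseteq> L n"
    and Union_L: "(\<Union>n. L n) = UNIV"
    and infT: "infinite (UNIV :: 't set)"
    and T_le_L: "|UNIV :: 't set| \<le>o |L n|"
    and nomaxT: "\<And>x :: 't. \<exists>y. x < y"
    and guess: "\<And>g. \<exists>\<alpha>. uncountable (C \<alpha>) \<and> C \<alpha> \<subseteq> cl g"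
    and segI: "\<And>x :: 'i. |{..<x}| \<le>o |UNIV :: 'l set|"
    and bddI: "\<And>Y :: 'i set. |Y| \<le>o |UNIV :: 'l set| \<Longrightarrow> \<exists>b. \<forall>y\<in>Y. y < b"
begin

text \<open>
  Meaningful only for those \<open>\<delta>\<close> that are the supremum of a continuous \<open>'t\<close>-sequence. For the other
  \<open>\<delta>\<close> it is an arbitrary function, which does no harm below since its range has at most
  \<open>'t\<close> many elements.
\<close>

definition ladder :: "'i \<Rightarrow> 't \<Rightarrow> 'i" where
  "ladder \<delta> = (SOME e. continuous_seq e \<and> has_sup e \<delta>)"

definition emb :: "'i \<Rightarrow> 'i \<Rightarrow> 'l" where
  "emb \<delta> = (SOME f. inj_on f {..<\<delta>})"

text \<open>The ladder of \<delta> is linked to \<delta> at every level, including level 0. This is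
  how \<delta> becomes an upper bound of a whole guessed set at one level.\<close>

definition link :: "nat \<Rightarrow> ('i \<times> 'i) set" where
  "link n = {(\<gamma>, \<delta>). \<gamma> < \<delta> \<and> (emb \<delta> \<gamma> \<in> L n \<or> \<gamma> \<in> range (ladder \<delta>))}"

definition below :: "nat \<Rightarrow> ('i \<times> 'i) set" where
  "below n = (link n)\<^sup>+"

lemma inj_emb: "inj_on (emb \<delta>) {..<\<delta>}"
proof -
  have "\<exists>f :: 'i \<Rightarrow> 'l. inj_on f {..<\<delta>}"
    using segI[of \<delta>] card_of_ordLeq[of "{..<\<delta>}" "UNIV :: 'l set"] by blast
  then show ?thesis
    unfolding emb_def by (rule someI_ex)
qed

lemma infinite_L: "infinite (L n)"
  by (rule card_of_ordLeq_infinite[OF T_le_L infT])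

lemma below_trans: "(x, y) \<in> below n \<Longrightarrow> (y, z) \<in> below n \<Longrightarrow> (x, z) \<in> below n"
  unfolding below_def by (rule trancl_trans)

lemma below_mono: "m \<le> n \<Longrightarrow> below m \<subseteq> below n"
  unfolding below_def using mono_L by (intro subrelI, elim trancl_mono) (auto simp: link_def)

lemma below_less:
  assumes "(x, y) \<in> below n"
  shows "x < y"
  using assms unfolding below_def by (induction rule: trancl_induct) (auto simp: link_def)

lemma below_exhausts:
  assumes "x < y"
  shows "\<exists>n. (x, y) \<in> below n"
proof -
  obtain n where "emb y x \<in> L n"
    using Union_L by blast
  then have "(x, y) \<in> link n"
    using assms by (simp add: link_def)
  then show ?thesis
    unfolding below_def by blast
qed

lemma card_link: "|{x. (x, y) \<in> link n}| \<le>o |L n|"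
proof -
  have "|{x\<in>{..<y}. emb y x \<in> L n}| \<le>o |L n|"
    using inj_emb[of y] by (intro card_of_ordLeqI[of "emb y"]) (auto simp: inj_on_def)
  moreover have "|range (ladder y)| \<le>o |L n|"
    by (rule ordLeq_transitive[OF card_of_image T_le_L])
  ultimately have "|{x\<in>{..<y}. emb y x \<in> L n} \<union> range (ladder y)| \<le>o |L n|"
    by (rule card_of_Un_ordLeq_infinite[OF infinite_L])
  moreover have "|{x. (x, y) \<in> link n}| \<le>o |{x\<in>{..<y}. emb y x \<in> L n} \<union> range (ladder y)|"
    by (rule card_of_mono1) (auto simp: link_def)
  ultimately show ?thesis
    using ordLeq_transitive by blast
qed

text \<open>Passing to the transitive closure is free: by induction on \<open>y\<close>, the
  predecessors of \<open>y\<close> are its at most \<open>|L n|\<close> links together with their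
  predecessors.\<close>

lemma card_below: "|{x. (x, y) \<in> below n}| \<le>o |L n|"
proof (induction y rule: less_induct)
  case (less y)
  have "|\<Union>z\<in>{z. (z, y) \<in> link n}. {z} \<union> {x. (x, z) \<in> below n}| \<le>o |L n|"
  proof (rule card_of_UNION_ordLeq_infinite[OF infinite_L card_link], intro ballI)
    fix z
    assume "z \<in> {z. (z, y) \<in> link n}"
    then have "z < y"
      by (simp add: link_def)
    then show "|{z} \<union> {x. (x, z) \<in> below n}| \<le>o |L n|"
      by (intro card_of_Un_ordLeq_infinite card_of_finite_ordLeq_infinite infinite_L less) simp
  qed
  moreover have "{x. (x, y) \<in> below n} \<subseteq> (\<Union>z\<in>{z. (z, y) \<in> link n}. {z} \<union> {x. (x, z) \<in> below n})"
    unfolding below_def by (auto elim: tranclE)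
  ultimately show ?case
    using card_of_mono1 ordLeq_transitive by blast
qed

text \<open>
  In \<open>anticipating_seq\<close>, each guess \<open>C \<alpha>\<close> cut off at \<open>k\<close> is served in advance: if the part of \<open>\<xi>\<close> on it has an
  upper bound in some level of the filtration, then there is such a bound \<open>\<sigma>\<close> below the next value
  of \<open>\<xi>\<close>, with a further element of \<open>X\<close> in between. Once \<open>\<xi>\<close> agrees with the ladder of its supremum
  \<open>\<delta>\<close> on \<open>C \<alpha>\<close>, the bound \<open>\<delta>\<close> itself shows that all these premises hold.
\<close>

definition anticipated :: "('t \<Rightarrow> 'i) \<Rightarrow> 'i set \<Rightarrow> 't set \<Rightarrow> nat \<Rightarrow> 'i \<Rightarrow> 'i \<Rightarrow> bool" where
  "anticipated \<xi> X S n \<sigma> x \<longleftrightarrow> \<xi> ` S \<times> {\<sigma>} \<subseteq> below n \<and> x \<in> X \<and> \<sigma> < x"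

definition anticipates :: "('t \<Rightarrow> 'i) \<Rightarrow> 'i set \<Rightarrow> 't set \<Rightarrow> 'i \<Rightarrow> bool" where
  "anticipates \<xi> X S v \<longleftrightarrow> (\<exists>n \<sigma>. \<xi> ` S \<times> {\<sigma>} \<subseteq> below n) \<longrightarrow> (\<exists>n \<sigma> x. anticipated \<xi> X S n \<sigma> x \<and> x < v)"

lemma bdd_imgT: "\<exists>b. \<forall>y\<in>Y. f y < b" if "|Y| \<le>o |UNIV :: 't set|" for Y :: "'y set" and f :: "'y \<Rightarrow> 'i"
proof -
  have "|f ` Y| \<le>o |UNIV :: 'l set|"
    by (rule ordLeq_transitive[OF card_of_image], rule ordLeq_transitive[OF that],
        rule ordLeq_transitive[OF T_le_L[of 0] card_of_mono1]) simp
  from bddI[OF this] show ?thesis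
    by blast
qed

text \<open>Recursion over \<open>'t\<close>. Each requirement reads only earlier values of the
  sequence, and a stage faces only the pairs (\<alpha>, \<open>k\<close>), no more than the elements
  of \<open>'t\<close>, so one value lies above all requested witnesses.\<close>

lemma anticipating_seq:
  assumes X: "\<And>\<delta> :: 'i. \<exists>b\<in>X. \<delta> < b"
  shows "\<exists>\<xi> :: 't \<Rightarrow> 'i. continuous_seq \<xi> \<and>
    (\<forall>i \<alpha> k. \<not> is_lim i \<longrightarrow> C \<alpha> \<inter> {..k} \<subseteq> {..<i} \<longrightarrow> anticipates \<xi> X (C \<alpha> \<inter> {..k}) (\<xi> i))"
proof -
  define P where "P \<xi> i v \<longleftrightarrow> (\<forall>j\<in>{..<i}. \<xi> j < v) \<and>
    (is_lim i \<longrightarrow> v = (LEAST b. \<forall>j\<in>{..<i}. \<xi> j < b)) \<and>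
    (\<not> is_lim i \<longrightarrow> (\<forall>\<alpha> k. C \<alpha> \<inter> {..k} \<subseteq> {..<i} \<longrightarrow> anticipates \<xi> X (C \<alpha> \<inter> {..k}) v))"
    for \<xi> :: "'t \<Rightarrow> 'i" and i v
  have "\<exists>\<xi>. \<forall>i. P \<xi> i (\<xi> i)"
  proof (rule dependent_wf_choice[OF wf])
    fix f g :: "'t \<Rightarrow> 'i" and i v
    assume "\<And>z. (z, i) \<in> {(x, y). x < y} \<Longrightarrow> f z = g z"
    then have fg: "f j = g j" if "j < i" for j
      using that by simp
    then have "f ` S = g ` S" if "S \<subseteq> {..<i}" for S
      using that by (intro image_cong) auto
    then have "anticipates f X S v = anticipates g X S v" if "S \<subseteq> {..<i}" for S
      using that unfolding anticipates_def anticipated_def by simp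
    moreover have "(\<forall>j\<in>{..<i}. f j < b) = (\<forall>j\<in>{..<i}. g j < b)" for b
      using fg by auto
    ultimately show "P f i v = P g i v"
      unfolding P_def by simp
  next
    fix i and \<xi> :: "'t \<Rightarrow> 'i"
    obtain b0 where b0: "\<forall>j\<in>{..<i}. \<xi> j < b0"
      using bdd_imgT[OF card_of_mono1[of "{..<i}" UNIV], of \<xi>] by auto
    show "\<exists>v. P \<xi> i v"
    proof (cases "is_lim i")
      case True
      then show ?thesis
        using LeastI[of "\<lambda>b. \<forall>j\<in>{..<i}. \<xi> j < b", OF b0] unfolding P_def by blast
    next
      case False
      have "\<exists>v. anticipates \<xi> X S v" for S
      proof (cases "\<exists>n \<sigma>. \<xi> ` S \<times> {\<sigma>} \<subseteq> below n")
        case True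
        then obtain n \<sigma> where "\<xi> ` S \<times> {\<sigma>} \<subseteq> below n"
          by blast
        moreover obtain x where "x \<in> X" "\<sigma> < x"
          using X by blast
        moreover obtain v where "x < v"
          using X by blast
        ultimately show ?thesis
          unfolding anticipates_def anticipated_def by blast
      qed (auto simp: anticipates_def)
      then obtain v where v: "\<And>S. anticipates \<xi> X S (v S)"
        by metis
      have "|(UNIV :: 't set) \<times> (UNIV :: 't set)| \<le>o |UNIV :: 't set|"
        by (rule ordIso_imp_ordLeq[OF card_of_Times_same_infinite[OF infT]])
      from bdd_imgT[OF this, of "\<lambda>(\<alpha>, k). v (C \<alpha> \<inter> {..k})"]
      obtain b1 where b1: "\<And>\<alpha> k. v (C \<alpha> \<inter> {..k}) < b1"
        by auto
      have "anticipates \<xi> X (C \<alpha> \<inter> {..k}) (max b0 b1)" for \<alpha> k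
        using v[of "C \<alpha> \<inter> {..k}"] b1[of \<alpha> k] unfolding anticipates_def
        by (meson less_max_iff_disj order_less_trans)
      moreover have "\<forall>j\<in>{..<i}. \<xi> j < max b0 b1"
        using b0 by (simp add: less_max_iff_disj)
      ultimately have "P \<xi> i (max b0 b1)"
        using False unfolding P_def by blast
      then show ?thesis ..
    qed
  qed
  then obtain \<xi> where "\<And>i. P \<xi> i (\<xi> i)"
    by blast
  then have "continuous_seq \<xi> \<and>
    (\<forall>i \<alpha> k. \<not> is_lim i \<longrightarrow> C \<alpha> \<inter> {..k} \<subseteq> {..<i} \<longrightarrow> anticipates \<xi> X (C \<alpha> \<inter> {..k}) (\<xi> i))"
    unfolding P_def continuous_seq_def strict_mono_def by simp
  then show ?thesis
    by blast
qed

text \<open>Between consecutive points of a guessed set, the sequence \<xi> passes a bound \<sigma>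
  of its earlier values there and then some \<open>x\<close> in \<open>X\<close>. Hence
  \<open>x k\<close> lies below \<xi> at the next point, which lies below a later \<sigma>, which
  lies below a later \<open>x\<close>. At a fixed level these relations compose.\<close>

lemma below_chain:
  assumes X: "\<And>\<delta> :: 'i. \<exists>b\<in>X. \<delta> < b"
  shows "\<exists>n (s :: nat \<Rightarrow> 'i). strict_mono s \<and> range s \<subseteq> X \<and> (\<forall>r m. r < m \<longrightarrow> (s r, s m) \<in> below n)"
proof -
  obtain \<xi> :: "'t \<Rightarrow> 'i" where \<xi>: "continuous_seq \<xi>"
    and anticipates: "\<And>i \<alpha> k. \<not> is_lim i \<Longrightarrow> C \<alpha> \<inter> {..k} \<subseteq> {..<i} \<Longrightarrow> anticipates \<xi> X (C \<alpha> \<inter> {..k}) (\<xi> i)"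
    using anticipating_seq[OF X] by blast
  have \<xi>_mono: "\<xi> i < \<xi> j \<longleftrightarrow> i < j" for i j
    using \<xi> unfolding continuous_seq_def by (simp add: strict_mono_less)
  define \<delta> where "\<delta> = (LEAST b. \<forall>i\<in>UNIV. \<xi> i < b)"
  have sup: "has_sup \<xi> \<delta>"
    unfolding has_sup_def \<delta>_def
    using less_Least_strict_ub_iff[OF bdd_imgT[OF card_of_mono1[OF subset_refl], of \<xi>]] by simp
  define e where "e = ladder \<delta>"
  have e: "continuous_seq e" "has_sup e \<delta>"
    using someI[of "\<lambda>e. continuous_seq e \<and> has_sup e \<delta>", OF conjI[OF \<xi> sup]]
    unfolding e_def ladder_def by auto
  obtain g where g: "\<And>i. i \<in> cl g \<Longrightarrow> \<xi> i = e i"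
    using cl_coincide[OF nomaxT \<xi> sup e] by blast
  obtain \<alpha> where \<alpha>: "uncountable (C \<alpha>)" "C \<alpha> \<subseteq> cl g"
    using guess by blast
  have \<xi>_\<delta>: "(\<xi> i, \<delta>) \<in> below 0" if "i \<in> C \<alpha>" for i
  proof -
    have "\<xi> i < \<delta>"
      using sup unfolding has_sup_def by blast
    moreover have "\<xi> i \<in> range (ladder \<delta>)"
      using g[of i] that \<alpha>(2) unfolding e_def by auto
    ultimately show ?thesis
      unfolding below_def link_def by auto
  qed
  \<comment> \<open>Removes a possible last element of \<open>C \<alpha>\<close>, so that every
    \<open>k\<close> in \<open>D\<close> has a next element.\<close>
  define D where "D = {k \<in> C \<alpha>. \<exists>j\<in>C \<alpha>. k < j}"
  have "\<forall>a\<in>C \<alpha> - D. \<forall>b\<in>C \<alpha> - D. a = b"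
    unfolding D_def by (auto simp: not_less intro: order.antisym)
  then have "C \<alpha> - D = {} \<or> (\<exists>a. C \<alpha> - D = {a})"
    by blast
  then have ctbl: "countable (C \<alpha> - D)"
    by (metis countable_empty countable_insert)
  have "C \<alpha> = D \<union> (C \<alpha> - D)"
    by (auto simp: D_def)
  then have "uncountable D"
    using \<alpha>(1) countable_Un[OF _ ctbl, of D] by metis
  define W where "W k k' \<sigma> x m \<longleftrightarrow> k' \<in> C \<alpha> \<and> (\<forall>j\<in>C \<alpha>. k < j \<longrightarrow> k' \<le> j) \<and> x \<in> X \<and>
      (\<forall>j\<in>C \<alpha>. j \<le> k \<longrightarrow> (\<xi> j, \<sigma>) \<in> below m) \<and> (\<sigma>, x) \<in> below m \<and> (x, \<xi> k') \<in> below m"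
    for k k' \<sigma> x m
  have "\<exists>k' \<sigma> x m. W k k' \<sigma> x m"
    if k: "k \<in> D" for k
  proof -
    define k' where "k' = (LEAST j. j \<in> C \<alpha> \<and> k < j)"
    \<comment> \<open>The successor of \<open>k\<close>: it is no limit, so anticipation applies,
      and it is at most the next point \<open>k'\<close> of the guessed set.\<close>
    define i where "i = (LEAST j. k < j)"
    have "\<exists>j. j \<in> C \<alpha> \<and> k < j"
      using k unfolding D_def by blast
    then have k': "k' \<in> C \<alpha> \<and> k < k'"
      unfolding k'_def by (rule LeastI_ex)
    have k'_le: "k' \<le> j" if "j \<in> C \<alpha>" "k < j" for j
      unfolding k'_def using that by (intro Least_le) simp
    have i: "k < i"
      unfolding i_def using nomaxT by (rule LeastI_ex)
    have i_le: "i \<le> j" if "k < j" for j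
      unfolding i_def using that by (rule Least_le)
    have "\<not> is_lim i"
      using i i_le unfolding is_lim_def by (metis leD)
    then have "anticipates \<xi> X (C \<alpha> \<inter> {..k}) (\<xi> i)"
      using i by (intro anticipates) auto
    moreover have "\<xi> ` (C \<alpha> \<inter> {..k}) \<times> {\<delta>} \<subseteq> below 0"
      using \<xi>_\<delta> by auto
    ultimately obtain n \<sigma> x where s: "anticipated \<xi> X (C \<alpha> \<inter> {..k}) n \<sigma> x" "x < \<xi> i"
      unfolding anticipates_def by blast
    have "\<xi> i \<le> \<xi> k'"
      using i_le[of k'] k' \<xi>_mono by (metis leD leI)
    then have "x < \<xi> k'"
      using s(2) by simp
    then obtain n' where n': "(x, \<xi> k') \<in> below n'"
      using below_exhausts by blast
    obtain n'' where n'': "(\<sigma>, x) \<in> below n''"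
      using below_exhausts s(1) unfolding anticipated_def by blast
    define m where "m = max n (max n' n'')"
    have "below n \<subseteq> below m" "below n' \<subseteq> below m" "below n'' \<subseteq> below m"
      by (rule below_mono; simp add: m_def)+
    note sub = this
    have img: "\<xi> ` (C \<alpha> \<inter> {..k}) \<times> {\<sigma>} \<subseteq> below n" and xX: "x \<in> X"
      using s(1) by (simp_all add: anticipated_def)
    have below: "(\<xi> j, \<sigma>) \<in> below m" if "j \<in> C \<alpha>" "j \<le> k" for j
    proof -
      have "(\<xi> j, \<sigma>) \<in> \<xi> ` (C \<alpha> \<inter> {..k}) \<times> {\<sigma>}"
        using that by simp
      then show ?thesis
        by (rule subsetD[OF subset_trans[OF img sub(1)]])
    qed
    have "(x, \<xi> k') \<in> below m" "(\<sigma>, x) \<in> below m"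
      using sub n' n'' by (auto dest: subsetD)
    with below xX show ?thesis
      using k' k'_le unfolding W_def by blast
  qed
  then obtain nx \<sigma> x m where "\<And>k. k \<in> D \<Longrightarrow> W k (nx k) (\<sigma> k) (x k) (m k)"
    by metis
  then have nx: "\<And>k. k \<in> D \<Longrightarrow> nx k \<in> C \<alpha>"
    "\<And>k j. k \<in> D \<Longrightarrow> j \<in> C \<alpha> \<Longrightarrow> k < j \<Longrightarrow> nx k \<le> j"
    and x: "\<And>k. k \<in> D \<Longrightarrow> x k \<in> X"
    and \<sigma>: "\<And>k j. k \<in> D \<Longrightarrow> j \<in> C \<alpha> \<Longrightarrow> j \<le> k \<Longrightarrow> (\<xi> j, \<sigma> k) \<in> below (m k)"
    and m: "\<And>k. k \<in> D \<Longrightarrow> (\<sigma> k, x k) \<in> below (m k)" "\<And>k. k \<in> D \<Longrightarrow> (x k, \<xi> (nx k)) \<in> below (m k)"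
    unfolding W_def by auto
  \<comment> \<open>The uncountability of the guessed set enters here: there are only countably many
    levels, so one level serves infinitely many \<open>k\<close>.\<close>
  have "\<exists>n. infinite {k\<in>D. m k = n}"
  proof (rule ccontr)
    assume "\<not> ?thesis"
    then have "countable (\<Union>n. {k\<in>D. m k = n})"
      by (intro countable_UN) (auto intro: countable_finite)
    moreover have "(\<Union>n. {k\<in>D. m k = n}) = D"
      by auto
    ultimately show False
      using \<open>uncountable D\<close> by simp
  qed
  then obtain n where inf: "infinite {k\<in>D. m k = n}"
    by blast
  obtain s :: "nat \<Rightarrow> 't" where s: "strict_mono s" "range s \<subseteq> {k\<in>D. m k = n}"
    using infinite_imp_strict_mono_seq[OF inf] by blast
  have sD: "s r \<in> D" "m (s r) = n" for r
    using s(2) by auto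
  have chain: "(x (s r), x (s l)) \<in> below n" if "r < l" for r l
  proof -
    have "nx (s r) \<le> s l"
      using sD(1)[of l] strict_monoD[OF s(1) that] by (intro nx(2) sD(1)) (simp_all add: D_def)
    then have "(\<xi> (nx (s r)), \<sigma> (s l)) \<in> below n"
      using \<sigma>[OF sD(1) nx(1)[OF sD(1)]] sD(2) by metis
    then show ?thesis
      using m(2)[OF sD(1), of r] m(1)[OF sD(1), of l] unfolding sD(2)
      by (blast intro: below_trans)
  qed
  have "strict_mono (\<lambda>r. x (s r))"
    using below_less[OF chain] by (simp add: strict_mono_def)
  moreover have "range (\<lambda>r. x (s r)) \<subseteq> X"
    using x[OF sD(1)] by auto
  ultimately show ?thesis
    using chain by (intro exI[of _ n] exI[of _ "\<lambda>r. x (s r)"]) simp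
qed

end

section \<open>Rank functions below lambda^+\<close>

text \<open>
  The bound \<open>M\<close> is uniform in \<open>\<beta>\<close>, so that countable unions remain small also when the
  cardinality has countable cofinality.
\<close>

definition small_ranks :: "('i::wellorder \<Rightarrow> 'i \<Rightarrow> 'l::wellorder) \<Rightarrow> bool" where
  "small_ranks \<rho> \<longleftrightarrow> (\<forall>d. \<exists>M :: 'l set. infinite M \<and> |M| <o |UNIV :: 'l set| \<and>
     (\<forall>\<beta>. |{\<gamma>. \<gamma> < \<beta> \<and> \<rho> \<beta> \<gamma> \<le> d}| \<le>o |M| ))"

text \<open>Here \<open>b\<close> plays the top index of a vector and \<open>s b\<close> the rest of
  its support. The conclusion bounds, by one \<open>d\<close>, all ranks at \<open>b m\<close> of
  indices other than \<open>b m\<close> in the first vectors up to the \<open>m\<close>-th.\<close>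

definition chain_ranks :: "('i::wellorder \<Rightarrow> 'i \<Rightarrow> 'l::wellorder) \<Rightarrow> bool" where
  "chain_ranks \<rho> \<longleftrightarrow> (\<forall>B s. (\<forall>\<delta>. \<exists>b\<in>B. \<delta> < b) \<and> (\<forall>b\<in>B. finite (s b) \<and> s b \<subseteq> {..<b}) \<longrightarrow>
     (\<exists>(b :: nat \<Rightarrow> 'i) d. strict_mono b \<and> range b \<subseteq> B \<and>
       (\<forall>m. \<forall>\<gamma>\<in>s (b m) \<union> (\<Union>r<m. insert (b r) (s (b r))). \<rho> (b m) \<gamma> \<le> d)))"

text \<open>Pigeonhole from regularity: if every fibre of \<open>f\<close> had a bound, a common
  bound of these bounds would bound \<open>B\<close>.\<close>

lemma unbounded_part:
  fixes B :: "'i::wellorder set" and f :: "'i \<Rightarrow> 'k"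
  assumes B: "\<And>\<delta>. \<exists>b\<in>B. \<delta> < b"
    and bdd: "\<And>g :: 'k \<Rightarrow> 'i. \<exists>b. \<forall>k. g k < b"
  shows "\<exists>k. \<forall>\<delta>. \<exists>b\<in>B. \<delta> < b \<and> f b = k"
proof (rule ccontr)
  assume "\<not> ?thesis"
  then have "\<forall>k. \<exists>\<delta>. \<forall>b\<in>B. f b = k \<longrightarrow> b \<le> \<delta>"
    by (metis not_le)
  then obtain g where g: "\<And>k b. b \<in> B \<Longrightarrow> f b = k \<Longrightarrow> b \<le> g k"
    by metis
  obtain \<delta> where \<delta>: "\<And>k. g k < \<delta>"
    using bdd by blast
  obtain b where "b \<in> B" "\<delta> < b"
    using B by blast
  then show False
    using g[OF \<open>b \<in> B\<close> refl] \<delta>[of "f b"] by simp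
qed

lemma countable_imp_suc_bounded:
  assumes "infinite (UNIV :: 'a set)" "countable Y"
  shows "\<exists>b :: 'a suc. \<forall>y\<in>Y. y < b"
proof (rule bounded_suc[OF assms(1)])
  have "|UNIV :: nat set| \<le>o |UNIV :: 'a set|"
    using assms(1) infinite_iff_card_of_nat by blast
  then show "|Y| \<le>o |UNIV :: 'a set|"
    by (rule ordLeq_transitive[OF countable_imp_card_of_nat[OF assms(2)]])
qed

lemma no_max_suc:
  assumes "infinite (UNIV :: 'a set)"
  shows "\<exists>y :: 'a suc. x < y"
  using countable_imp_suc_bounded[OF assms, of "{x}"] by simp

text \<open>Club guessing with ladders of size omega_1 and omega_2 many stages.\<close>

lemma omega3_guessing:
  "\<exists>C :: nat suc suc suc \<Rightarrow> nat suc suc suc set. \<forall>g. \<exists>\<alpha>. uncountable (C \<alpha>) \<and> C \<alpha> \<subseteq> cl g"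
proof (rule club_guessing)
  show "countable Y \<Longrightarrow> \<exists>b. \<forall>y\<in>Y. y < b" for Y :: "nat suc set"
    by (rule countable_imp_suc_bounded) simp_all
  show "|UNIV :: nat suc set| <o |UNIV :: nat suc suc set|"
    by (rule card_of_suc_greater)
  show "\<exists>b. \<forall>y\<in>Y. y < b" if "|Y| \<le>o |UNIV :: nat suc suc set|" for Y :: "nat suc suc suc set"
    using that by (intro bounded_suc infinite_suc) simp_all
  show "|{..x}| \<le>o |UNIV :: nat suc suc set|" for x :: "nat suc suc suc"
    by (intro card_of_atMost_suc infinite_suc) simp
qed

text \<open>Arbitrary injections of the segments below \<beta> serve as ranks. Any increasing
  sequence in \<open>B\<close> works, since it involves only countably many ranks.\<close>

lemma ranks_countably_directed:
  assumes dir: "\<And>Y :: 'a card_ord set. countable Y \<Longrightarrow> \<exists>b. \<forall>y\<in>Y. y \<le> b"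
    and unc: "|UNIV :: nat set| <o |UNIV :: 'a set|"
  shows "\<exists>\<rho> :: 'a suc \<Rightarrow> 'a suc \<Rightarrow> 'a card_ord. small_ranks \<rho> \<and> chain_ranks \<rho>"
proof -
  have inf: "infinite (UNIV :: 'a set)"
    by (rule infinite_iff_card_of_nat[THEN iffD2, OF ordLess_imp_ordLeq[OF unc]])
  have inf': "infinite (UNIV :: 'a card_ord set)"
    by (simp add: card_of_ordIso_finite[OF card_of_card_ord] inf)
  have "\<exists>f :: 'a suc \<Rightarrow> 'a card_ord. inj_on f {..<\<beta>}" for \<beta>
  proof -
    have "|{..<\<beta>}| \<le>o |UNIV :: 'a card_ord set|"
      by (rule ordLeq_ordIso_trans[OF card_of_lessThan_suc ordIso_symmetric[OF card_of_card_ord]])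
    then show ?thesis
      using card_of_ordLeq[of "{..<\<beta>}" "UNIV :: 'a card_ord set"] by blast
  qed
  then obtain \<rho> :: "'a suc \<Rightarrow> 'a suc \<Rightarrow> 'a card_ord" where \<rho>: "\<And>\<beta>. inj_on (\<rho> \<beta>) {..<\<beta>}"
    by metis
  have "small_ranks \<rho>"
    unfolding small_ranks_def
  proof
    fix d :: "'a card_ord"
    obtain f :: "nat \<Rightarrow> 'a card_ord" where f: "inj f"
      using infinite_countable_subset[OF inf'] by blast
    \<comment> \<open>The injectivity of the ranks bounds the set by the segment up to
      \<open>d\<close>; \<open>range f\<close> is added to make \<open>M\<close> infinite when that
      segment is finite.\<close>
    define M where "M = {..<d} \<union> ({d} \<union> range f)"
    have "|{..<d}| <o |UNIV :: 'a card_ord set|"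
      by (rule ordLess_ordIso_trans[OF card_of_lessThan_card_ord ordIso_symmetric[OF card_of_card_ord]])
    moreover have "|{d} \<union> range f| \<le>o |UNIV :: nat set|"
      by (intro countable_imp_card_of_nat) simp
    then have "|{d} \<union> range f| <o |UNIV :: 'a card_ord set|"
      by (rule ordLeq_ordLess_trans[OF _ ordLess_ordIso_trans[OF unc ordIso_symmetric[OF card_of_card_ord]]])
    ultimately have "|M| <o |UNIV :: 'a card_ord set|"
      unfolding M_def by (rule card_of_Un_ordLess_infinite[OF inf'])
    moreover have "infinite M"
      using range_inj_infinite[OF f] by (simp add: M_def)
    moreover have "|{\<gamma>. \<gamma> < \<beta> \<and> \<rho> \<beta> \<gamma> \<le> d}| \<le>o |M|" for \<beta>
      using \<rho>[of \<beta>] by (intro card_of_ordLeqI[of "\<rho> \<beta>"]) (auto simp: M_def inj_on_def)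
    ultimately show "\<exists>M :: 'a card_ord set. infinite M \<and> |M| <o |UNIV :: 'a card_ord set| \<and>
       (\<forall>\<beta>. |{\<gamma>. \<gamma> < \<beta> \<and> \<rho> \<beta> \<gamma> \<le> d}| \<le>o |M| )"
      by blast
  qed
  moreover have "chain_ranks \<rho>"
    unfolding chain_ranks_def
  proof (intro allI impI, elim conjE)
    fix B :: "'a suc set" and s
    assume B: "\<forall>\<delta>. \<exists>b\<in>B. \<delta> < b" and s: "\<forall>b\<in>B. finite (s b) \<and> s b \<subseteq> {..<b}"
    have "infinite B"
    proof
      assume "finite B"
      moreover obtain b where "b \<in> B" "Max B < b"
        using B by blast
      ultimately show False
        using Max_ge leD by blast
    qed
    from infinite_imp_strict_mono_seq[OF this]
    obtain b :: "nat \<Rightarrow> 'a suc" where b: "strict_mono b" "range b \<subseteq> B"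
      by blast
    define S where "S m = s (b m) \<union> (\<Union>r<m. insert (b r) (s (b r)))" for m
    have "finite (S m)" for m
      using s b(2) unfolding S_def by auto
    then have "countable (\<Union>m. \<rho> (b m) ` S m)"
      by (intro countable_UN countable_image) (auto intro: countable_finite)
    then obtain d where d: "\<And>m \<gamma>. \<gamma> \<in> S m \<Longrightarrow> \<rho> (b m) \<gamma> \<le> d"
      using dir[of "\<Union>m. \<rho> (b m) ` S m"] by auto
    show "\<exists>(b :: nat \<Rightarrow> 'a suc) d. strict_mono b \<and> range b \<subseteq> B \<and>
        (\<forall>m. \<forall>\<gamma>\<in>s (b m) \<union> (\<Union>r<m. insert (b r) (s (b r))). \<rho> (b m) \<gamma> \<le> d)"
      using b d unfolding S_def by (intro exI[of _ b] exI[of _ d] conjI allI ballI)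
  qed
  ultimately show ?thesis
    by blast
qed

text \<open>Otherwise every proper initial segment would have at most the cardinality of
  \<open>'b\<close>, and so would the union of countably many of them, which is everything.\<close>

lemma suc_less_of_countable_cofinality:
  fixes y :: "nat \<Rightarrow> 'a card_ord"
  assumes cof: "\<And>d. \<exists>n. d < y n"
    and inf: "infinite (UNIV :: 'b set)" and less: "|UNIV :: 'b set| <o |UNIV :: 'a set|"
  shows "|UNIV :: 'b suc set| <o |UNIV :: 'a set|"
proof (rule ccontr)
  assume "\<not> ?thesis"
  then have le: "|UNIV :: 'a set| \<le>o |UNIV :: 'b suc set|"
    using not_ordLess_iff_ordLeq[OF card_of_Well_order card_of_Well_order] by blast
  have "|{..<y n}| \<le>o |UNIV :: 'b set|" for n
    using ordLess_ordLeq_trans[OF card_of_lessThan_card_ord le] card_of_less_suc_iff by blast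
  then have "|\<Union>n. {..<y n}| \<le>o |UNIV :: 'b set|"
    using inf infinite_iff_card_of_nat by (intro card_of_UNION_ordLeq_infinite) blast+
  moreover have "(\<Union>n. {..<y n}) = UNIV"
    using cof by auto
  ultimately have "|UNIV :: 'a card_ord set| \<le>o |UNIV :: 'b set|"
    by simp
  then have "|UNIV :: 'a set| \<le>o |UNIV :: 'b set|"
    by (rule ordIso_ordLeq_trans[OF ordIso_symmetric[OF card_of_card_ord]])
  then show False
    using not_ordLess_ordLeq[OF less] by blast
qed

text \<open>The rank of \<gamma> below \<beta> encodes the least filtration level relating them.
  Transitivity passes the bound from a support to its top index and on to every later top index of
  the chain.\<close>

lemma ranks_countable_cofinality:
  fixes y :: "nat \<Rightarrow> 'a card_ord"
  assumes cof: "\<And>d. \<exists>n. d < y n"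
    and unc: "|UNIV :: nat set| <o |UNIV :: 'a set|"
  shows "\<exists>\<rho> :: 'a suc \<Rightarrow> 'a suc \<Rightarrow> 'a card_ord. small_ranks \<rho> \<and> chain_ranks \<rho>"
proof -
  have inf: "infinite (UNIV :: 'a set)"
    by (rule infinite_iff_card_of_nat[THEN iffD2, OF ordLess_imp_ordLeq[OF unc]])
  have inf': "infinite (UNIV :: 'a card_ord set)"
    by (simp add: card_of_ordIso_finite[OF card_of_card_ord] inf)
  \<comment> \<open>Three applications starting from omega: an uncountable cardinal of countable
    cofinality exceeds omega_1, omega_2 and omega_3 in turn.\<close>
  have "|UNIV :: nat suc suc suc set| <o |UNIV :: 'a set|"
    by (intro suc_less_of_countable_cofinality[OF cof] infinite_suc unc) simp_all
  then have T: "|UNIV :: nat suc suc suc set| <o |UNIV :: 'a card_ord set|"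
    by (rule ordLess_ordIso_trans[OF _ ordIso_symmetric[OF card_of_card_ord]])
  obtain f :: "nat suc suc suc \<Rightarrow> 'a card_ord" where f: "inj f"
    using ordLess_imp_ordLeq[OF T] card_of_ordLeq[of "UNIV :: nat suc suc suc set" "UNIV :: 'a card_ord set"]
    by blast
  \<comment> \<open>A copy of omega_3 is put into each level, so that adding a ladder does not
    exceed the size of the level.\<close>
  define L where "L n = (\<Union>k\<le>n. {..<y k}) \<union> range f" for n
  have less_L: "|L n| <o |UNIV :: 'a card_ord set|" for n
  proof -
    have "|\<Union>k\<le>n. {..<y k}| <o |UNIV :: 'a card_ord set|"
    proof (induction n)
      case 0
      show ?case
        by (simp add: ordLess_ordIso_trans[OF card_of_lessThan_card_ord ordIso_symmetric[OF card_of_card_ord]])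
    next
      case (Suc n)
      then show ?case
        unfolding atMost_Suc UN_insert
        by (intro card_of_Un_ordLess_infinite[OF inf']
            ordLess_ordIso_trans[OF card_of_lessThan_card_ord ordIso_symmetric[OF card_of_card_ord]])
    qed
    moreover have "|range f| <o |UNIV :: 'a card_ord set|"
      by (rule ordLeq_ordLess_trans[OF card_of_image T])
    ultimately show ?thesis
      unfolding L_def by (rule card_of_Un_ordLess_infinite[OF inf'])
  qed
  obtain C :: "nat suc suc suc \<Rightarrow> nat suc suc suc set" where
    C: "\<And>g. \<exists>\<alpha>. uncountable (C \<alpha>) \<and> C \<alpha> \<subseteq> cl g"
    using omega3_guessing by blast
  interpret filtration_setup L C "TYPE('a suc)"
  proof
    show "m \<le> n \<Longrightarrow> L m \<subseteq> L n" for m n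
      unfolding L_def by fastforce
    show "(\<Union>n. L n) = UNIV"
      using cof unfolding L_def by fastforce
    show "infinite (UNIV :: nat suc suc suc set)"
      by (intro infinite_suc) simp
    show "|UNIV :: nat suc suc suc set| \<le>o |L n|" for n
      using f by (intro card_of_ordLeqI[of f]) (auto simp: L_def)
    show "\<exists>y. x < y" for x :: "nat suc suc suc"
      by (intro no_max_suc infinite_suc) simp
    show "\<exists>\<alpha>. uncountable (C \<alpha>) \<and> C \<alpha> \<subseteq> cl g" for g
      by (rule C)
    show "|{..<x}| \<le>o |UNIV :: 'a card_ord set|" for x :: "'a suc"
      by (rule ordLeq_ordIso_trans[OF card_of_lessThan_suc ordIso_symmetric[OF card_of_card_ord]])
    show "\<exists>b. \<forall>y\<in>Y. y < b" if "|Y| \<le>o |UNIV :: 'a card_ord set|" for Y :: "'a suc set"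
      by (rule bounded_suc[OF inf], rule ordLeq_ordIso_trans[OF that card_of_card_ord])
  qed
  \<comment> \<open>The running maximum of \<open>y\<close> is monotone and still cofinal, so a
    bound on ranks translates into a bound on levels.\<close>
  define z where "z n = Max (y ` {..n})" for n
  have z_mono: "z m \<le> z n" if "m \<le> n" for m n
    unfolding z_def using that by (intro Max_mono) auto
  have z_cof: "\<exists>n. d < z n" for d
  proof -
    obtain n where "d < y n"
      using cof by blast
    also have "y n \<le> z n"
      unfolding z_def by (intro Max_ge) auto
    finally show ?thesis ..
  qed
  define c where "c \<beta> \<gamma> = (LEAST n. (\<gamma>, \<beta>) \<in> below n)" for \<beta> \<gamma>
  have c_in: "(\<gamma>, \<beta>) \<in> below (c \<beta> \<gamma>)" if "\<gamma> < \<beta>" for \<beta> \<gamma>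
    unfolding c_def using below_exhausts[OF that] by (rule LeastI_ex)
  have c_le: "c \<beta> \<gamma> \<le> n" if "(\<gamma>, \<beta>) \<in> below n" for \<beta> \<gamma> n
    unfolding c_def using that by (rule Least_le)
  define \<rho> where "\<rho> \<beta> \<gamma> = z (c \<beta> \<gamma>)" for \<beta> \<gamma>
  have "small_ranks \<rho>"
    unfolding small_ranks_def
  proof
    fix d
    obtain n where n: "d < z n"
      using z_cof by blast
    have "|{\<gamma>. \<gamma> < \<beta> \<and> \<rho> \<beta> \<gamma> \<le> d}| \<le>o |L n|" for \<beta>
    proof (rule ordLeq_transitive[OF card_of_mono1 card_below[of \<beta>]], safe)
      fix \<gamma>
      assume "\<gamma> < \<beta>" "\<rho> \<beta> \<gamma> \<le> d"
      then have "c \<beta> \<gamma> \<le> n"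
        using n z_mono[of n "c \<beta> \<gamma>"] unfolding \<rho>_def by (meson leD le_cases order_trans)
      then show "(\<gamma>, \<beta>) \<in> below n"
        using c_in[OF \<open>\<gamma> < \<beta>\<close>] below_mono by blast
    qed
    then show "\<exists>M :: 'a card_ord set. infinite M \<and> |M| <o |UNIV :: 'a card_ord set| \<and>
       (\<forall>\<beta>. |{\<gamma>. \<gamma> < \<beta> \<and> \<rho> \<beta> \<gamma> \<le> d}| \<le>o |M| )"
      using less_L[of n] infinite_L[of n] by blast
  qed
  moreover have "chain_ranks \<rho>"
    unfolding chain_ranks_def
  proof (intro allI impI, elim conjE)
    fix B :: "'a suc set" and s
    assume B: "\<forall>\<delta>. \<exists>b\<in>B. \<delta> < b" and s: "\<forall>b\<in>B. finite (s b) \<and> s b \<subseteq> {..<b}"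
    \<comment> \<open>A level at which all of the finite set \<open>s b\<close> is below
      \<open>b\<close>; the element 0 covers empty \<open>s b\<close>. Regularity then fixes this
      level on an unbounded part of \<open>B\<close>.\<close>
    define k where "k b = Max (insert 0 (c b ` s b))" for b
    have k: "(\<gamma>, b) \<in> below (k b)" if "b \<in> B" "\<gamma> \<in> s b" for b \<gamma>
    proof -
      have "c b \<gamma> \<le> k b"
        unfolding k_def using that s by (intro Max_ge) auto
      moreover have "\<gamma> < b"
        using that s by blast
      ultimately show ?thesis
        using c_in below_mono by blast
    qed
    have "\<exists>k0. \<forall>\<delta>. \<exists>b\<in>B. \<delta> < b \<and> k b = k0"
    proof (rule unbounded_part)
      show "\<exists>b. \<forall>n. g n < b" for g :: "nat \<Rightarrow> 'a suc"
        using countable_imp_suc_bounded[OF inf, of "range g"] by auto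
    qed (use B in blast)
    then obtain k0 where "\<And>\<delta>. \<exists>b\<in>{b\<in>B. k b = k0}. \<delta> < b"
      by blast
    from below_chain[OF this] obtain n and b :: "nat \<Rightarrow> 'a suc" where b: "strict_mono b"
      "range b \<subseteq> {b\<in>B. k b = k0}" "\<And>r m. r < m \<Longrightarrow> (b r, b m) \<in> below n"
      by blast
    have bB: "b m \<in> B" "k (b m) = k0" for m
      using b(2) by auto
    define l where "l = max k0 n"
    have l: "below k0 \<subseteq> below l" "below n \<subseteq> below l"
      by (rule below_mono; simp add: l_def)+
    have d: "\<rho> (b m) \<gamma> \<le> z l" if \<gamma>: "\<gamma> \<in> s (b m) \<union> (\<Union>r<m. insert (b r) (s (b r)))" for m \<gamma>
    proof -
      have own: "(\<gamma>, b r) \<in> below l" if "\<gamma> \<in> s (b r)" for r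
        using k[OF bB(1) that] l(1) unfolding bB(2) by blast
      have step: "(b r, b m) \<in> below l" if "r < m" for r
        using b(3)[OF that] l(2) by blast
      have "(\<gamma>, b m) \<in> below l"
        using \<gamma> own step below_trans by blast
      then show ?thesis
        unfolding \<rho>_def by (intro z_mono c_le)
    qed
    show "\<exists>(b :: nat \<Rightarrow> 'a suc) d. strict_mono b \<and> range b \<subseteq> B \<and>
        (\<forall>m. \<forall>\<gamma>\<in>s (b m) \<union> (\<Union>r<m. insert (b r) (s (b r))). \<rho> (b m) \<gamma> \<le> d)"
      using b(1) bB(1) d by (intro exI[of _ b] exI[of _ "z l"] conjI allI ballI) auto
  qed
  ultimately show ?thesis
    by blast
qed

lemma ranks_exist:
  assumes unc: "|UNIV :: nat set| <o |UNIV :: 'a set|"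
  shows "\<exists>\<rho> :: 'a suc \<Rightarrow> 'a suc \<Rightarrow> 'a card_ord. small_ranks \<rho> \<and> chain_ranks \<rho>"
proof (cases "\<forall>Y :: 'a card_ord set. countable Y \<longrightarrow> (\<exists>b. \<forall>y\<in>Y. y \<le> b)")
  case True
  then show ?thesis
    using ranks_countably_directed[OF _ unc] by blast
next
  case False
  then obtain Y :: "'a card_ord set" where Y: "countable Y" "\<And>b. \<exists>y\<in>Y. b < y"
    by (auto simp: not_le)
  have "\<exists>n. d < from_nat_into Y n" for d
    using Y(2)[of d] from_nat_into_surj[OF Y(1)] by metis
  then show ?thesis
    by (rule ranks_countable_cofinality[OF _ unc])
qed

section \<open>Generated subfields\<close>

text \<open>The subfield generated by \<open>X\<close>; the convention \<open>inverse 0 = 0\<close>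
  makes the unrestricted rule for inverses harmless.\<close>

inductive_set gen :: "'f::field set \<Rightarrow> 'f set" for X where
  base: "x \<in> X \<Longrightarrow> x \<in> gen X"
| zero: "0 \<in> gen X"
| one: "1 \<in> gen X"
| uminus: "x \<in> gen X \<Longrightarrow> - x \<in> gen X"
| inverse: "x \<in> gen X \<Longrightarrow> inverse x \<in> gen X"
| add: "x \<in> gen X \<Longrightarrow> y \<in> gen X \<Longrightarrow> x + y \<in> gen X"
| mult: "x \<in> gen X \<Longrightarrow> y \<in> gen X \<Longrightarrow> x * y \<in> gen X"

lemma gen_diff: "x \<in> gen X \<Longrightarrow> y \<in> gen X \<Longrightarrow> x - y \<in> gen X"
  using gen.add[OF _ gen.uminus] by fastforce

lemma gen_divide: "x \<in> gen X \<Longrightarrow> y \<in> gen X \<Longrightarrow> x / y \<in> gen X"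
  unfolding divide_inverse by (intro gen.mult gen.inverse)

lemma gen_sum: "(\<And>a. a \<in> A \<Longrightarrow> f a \<in> gen X) \<Longrightarrow> sum f A \<in> gen X"
  by (induction A rule: infinite_finite_induct) (auto intro: gen.zero gen.add)

lemma card_of_Times_ordLeq_infinite:
  assumes "infinite C" "|A| \<le>o |C|" "|B| \<le>o |C|"
  shows "|A \<times> B| \<le>o |C|"
  using assms
  by (intro card_of_Times_ordLeq_infinite_Field[OF _ _ _ card_of_Card_order]) (auto simp: Field_card_of)

text \<open>Closing under the field operations omega times exhausts the subfield, and no single step
  raises an infinite cardinality.\<close>

lemma card_of_gen_infinite:
  assumes "infinite X"
  shows "|gen X| \<le>o |X|"
proof -
  define step where "step A = A \<union> ({0, 1} \<union> (uminus ` A \<union> (inverse ` A \<union>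
    (case_prod (+) ` (A \<times> A) \<union> case_prod (*) ` (A \<times> A)))))" for A :: "'a set"
  define S where "S n = (step ^^ n) X" for n
  have S_Suc: "S (Suc n) = step (S n)" for n
    by (simp add: S_def)
  have card: "|S n| \<le>o |X|" for n
  proof (induction n)
    case 0
    show ?case
      by (simp add: S_def card_of_mono1)
  next
    case (Suc n)
    have img: "|f ` S n| \<le>o |X|" for f :: "'a \<Rightarrow> 'a"
      by (rule ordLeq_transitive[OF card_of_image Suc])
    have "|S n \<times> S n| \<le>o |X|"
      by (rule card_of_Times_ordLeq_infinite[OF assms Suc Suc])
    then have img2: "|f ` (S n \<times> S n)| \<le>o |X|" for f :: "'a \<times> 'a \<Rightarrow> 'a"
      by (rule ordLeq_transitive[OF card_of_image])
    show ?case
      unfolding S_Suc step_def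
      by (intro card_of_Un_ordLeq_infinite[OF assms] Suc img img2
          card_of_finite_ordLeq_infinite[OF assms]) simp_all
  qed
  have S_mono: "S m \<subseteq> S n" if "m \<le> n" for m n
    using that by (rule lift_Suc_mono_le[of S, rotated]) (auto simp: S_Suc step_def)
  have "gen X \<subseteq> (\<Union>n. S n)"
  proof
    fix x
    assume "x \<in> gen X"
    then have "\<exists>n. x \<in> S n"
    proof induction
      case (base x)
      then have "x \<in> S 0"
        by (simp add: S_def)
      then show ?case ..
    next
      case zero
      have "0 \<in> S (Suc 0)"
        by (simp add: S_Suc step_def)
      then show ?case ..
    next
      case one
      have "1 \<in> S (Suc 0)"
        by (simp add: S_Suc step_def)
      then show ?case ..
    next
      case (uminus x)
      then obtain n where "x \<in> S n"
        by blast
      then have "- x \<in> S (Suc n)"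
        by (simp add: S_Suc step_def)
      then show ?case ..
    next
      case (inverse x)
      then obtain n where "x \<in> S n"
        by blast
      then have "inverse x \<in> S (Suc n)"
        by (simp add: S_Suc step_def)
      then show ?case ..
    next
      case (add x y)
      then obtain m n where "x \<in> S m" "y \<in> S n"
        by blast
      then have "(x, y) \<in> S (max m n) \<times> S (max m n)"
        using S_mono[of m "max m n"] S_mono[of n "max m n"] by auto
      then have "case_prod (+) (x, y) \<in> S (Suc (max m n))"
        unfolding S_Suc step_def by blast
      then show ?case
        by auto
    next
      case (mult x y)
      then obtain m n where "x \<in> S m" "y \<in> S n"
        by blast
      then have "(x, y) \<in> S (max m n) \<times> S (max m n)"
        using S_mono[of m "max m n"] S_mono[of n "max m n"] by auto
      then have "case_prod (*) (x, y) \<in> S (Suc (max m n))"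
        unfolding S_Suc step_def by blast
      then show ?case
        by auto
    qed
    then show "x \<in> (\<Union>n. S n)"
      by blast
  qed
  then have "|gen X| \<le>o |\<Union>n. S n|"
    by (rule card_of_mono1)
  moreover have "|\<Union>n. S n| \<le>o |X|"
  proof (rule card_of_UNION_ordLeq_infinite[OF assms])
    show "|UNIV :: nat set| \<le>o |X|"
      using assms by (simp add: infinite_iff_card_of_nat)
  qed (use card in blast)
  ultimately show ?thesis
    by (rule ordLeq_transitive)
qed

lemma gen_mono: "X \<subseteq> Y \<Longrightarrow> gen X \<subseteq> gen Y"
proof
  fix x
  assume "X \<subseteq> Y" "x \<in> gen X"
  from this(2) show "x \<in> gen Y"
    by induction (use \<open>X \<subseteq> Y\<close> in \<open>auto intro: gen.intros\<close>)
qed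

text \<open>A countably infinite set is adjoined to cover finite \<open>X\<close>; because the field
  is uncountable, the generating set remains small.\<close>

lemma card_of_gen_less:
  fixes X :: "'f::field set"
  assumes "|X| <o |UNIV :: 'f set|" and unc: "|UNIV :: nat set| <o |UNIV :: 'f set|"
  shows "|gen X| <o |UNIV :: 'f set|"
proof -
  have inf: "infinite (UNIV :: 'f set)"
    by (rule infinite_iff_card_of_nat[THEN iffD2, OF ordLess_imp_ordLeq[OF unc]])
  obtain f :: "nat \<Rightarrow> 'f" where f: "inj f"
    using infinite_countable_subset[OF inf] by blast
  have "|range f| <o |UNIV :: 'f set|"
    by (rule ordLeq_ordLess_trans[OF card_of_image unc])
  then have less: "|X \<union> range f| <o |UNIV :: 'f set|"
    by (rule card_of_Un_ordLess_infinite[OF inf assms(1)])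
  have "|gen X| \<le>o |gen (X \<union> range f)|"
    by (intro card_of_mono1 gen_mono) simp
  also have "|gen (X \<union> range f)| \<le>o |X \<union> range f|"
    by (rule card_of_gen_infinite) (simp add: range_inj_infinite[OF f])
  finally show ?thesis
    using less by (rule ordLeq_ordLess_trans)
qed

section \<open>Linear systems over a subfield\<close>

text \<open>Gaussian elimination, all of whose operations stay inside the subfield.\<close>

lemma underdetermined_system:
  fixes M :: "'r \<Rightarrow> 'c \<Rightarrow> 'f::field"
  assumes "finite R" "finite s" "card R < card s"
    and "\<And>r a. r \<in> R \<Longrightarrow> a \<in> s \<Longrightarrow> M r a \<in> gen X"
  shows "\<exists>b. (\<forall>a\<in>s. b a \<in> gen X) \<and> (\<exists>a\<in>s. b a \<noteq> 0) \<and> (\<forall>r\<in>R. (\<Sum>a\<in>s. b a * M r a) = 0)"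
  using assms
proof (induction R arbitrary: s M rule: finite_induct)
  case empty
  then have "s \<noteq> {}"
    by auto
  then show ?case
    by (intro exI[of _ "\<lambda>_. 1"]) (auto intro: gen.one)
next
  case (insert r R)
  show ?case
  proof (cases "\<forall>a\<in>s. M r a = 0")
    case True
    have "\<exists>b. (\<forall>a\<in>s. b a \<in> gen X) \<and> (\<exists>a\<in>s. b a \<noteq> 0) \<and> (\<forall>r\<in>R. (\<Sum>a\<in>s. b a * M r a) = 0)"
      using insert by (intro insert.IH) auto
    then show ?thesis
      using True by auto
  next
    case False
    then obtain p where p: "p \<in> s" "M r p \<noteq> 0"
      by blast
    \<comment> \<open>Row \<open>r\<close> eliminates the pivot unknown \<open>p\<close> from the
      other rows.\<close>
    define M' where "M' r' a = M r' a - M r' p * M r a / M r p" for r' a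
    have "\<exists>b. (\<forall>a\<in>s - {p}. b a \<in> gen X) \<and> (\<exists>a\<in>s - {p}. b a \<noteq> 0) \<and>
        (\<forall>r'\<in>R. (\<Sum>a\<in>s - {p}. b a * M' r' a) = 0)"
      using insert p by (intro insert.IH)
        (auto simp: M'_def intro!: gen_diff gen_divide gen.mult)
    then obtain b where b: "\<And>a. a \<in> s - {p} \<Longrightarrow> b a \<in> gen X" "\<exists>a\<in>s - {p}. b a \<noteq> 0"
      "\<And>r'. r' \<in> R \<Longrightarrow> (\<Sum>a\<in>s - {p}. b a * M' r' a) = 0"
      by blast
    define t where "t = (\<Sum>a\<in>s - {p}. b a * M r a)"
    \<comment> \<open>Back substitution: the value at \<open>p\<close> is the one forced by row
      \<open>r\<close>.\<close>
    define c where "c a = (if a = p then - t / M r p else b a)" for a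
    have sum_c: "(\<Sum>a\<in>s. c a * M r' a) = - t / M r p * M r' p + (\<Sum>a\<in>s - {p}. b a * M r' a)" for r'
    proof -
      have "(\<Sum>a\<in>s - {p}. c a * M r' a) = (\<Sum>a\<in>s - {p}. b a * M r' a)"
        by (intro sum.cong) (auto simp: c_def)
      then show ?thesis
        using sum.remove[OF \<open>finite s\<close> p(1), of "\<lambda>a. c a * M r' a"] by (simp add: c_def)
    qed
    have "t \<in> gen X"
      unfolding t_def using insert.prems b(1) by (intro gen_sum gen.mult) auto
    then have "\<forall>a\<in>s. c a \<in> gen X"
      unfolding c_def using insert.prems p b(1) by (auto intro!: gen_divide gen.uminus)
    moreover have "\<exists>a\<in>s. c a \<noteq> 0"
      using b(2) by (auto simp: c_def)
    moreover have "(\<Sum>a\<in>s. c a * M r a) = 0"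
      using p(2) by (simp add: sum_c t_def[symmetric])
    moreover have "(\<Sum>a\<in>s. c a * M r' a) = 0" if "r' \<in> R" for r'
    proof -
      have "0 = (\<Sum>a\<in>s - {p}. b a * M r' a - b a * M r a * (M r' p / M r p))"
        using b(3)[OF that] by (simp add: M'_def algebra_simps)
      also have "\<dots> = (\<Sum>a\<in>s - {p}. b a * M r' a) - t * (M r' p / M r p)"
        unfolding sum_subtractf t_def sum_distrib_right by simp
      finally show ?thesis
        by (simp add: sum_c)
    qed
    ultimately show ?thesis
      by blast
  qed
qed

text \<open>
  By induction, all rows but the last determine the solution up to a factor, and this solution can
  be taken over the subfield. The last equation would then put the entry \<open>M m p\<close> into the subfield.
\<close>

lemma generic_rows_injective:
  fixes M :: "nat \<Rightarrow> 'c \<Rightarrow> 'f::field"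
  assumes "finite s"
    and generic: "\<And>s' m. s' \<subseteq> s \<Longrightarrow> card s' = Suc m \<Longrightarrow> \<exists>p\<in>s'. \<exists>X.
      (\<forall>r<m. \<forall>a\<in>s'. M r a \<in> gen X) \<and> (\<forall>a\<in>s' - {p}. M m a \<in> gen X) \<and> M m p \<notin> gen X"
    and zero: "\<And>r. r < card s \<Longrightarrow> (\<Sum>a\<in>s. b a * M r a) = 0"
  shows "\<forall>a\<in>s. b a = 0"
  using assms
proof (induction "card s" arbitrary: s b)
  case 0
  then show ?case
    by simp
next
  case (Suc m)
  note zero = Suc.prems(3)
  obtain p X where p: "p \<in> s" and X: "\<And>r a. r < m \<Longrightarrow> a \<in> s \<Longrightarrow> M r a \<in> gen X"
    "\<And>a. a \<in> s - {p} \<Longrightarrow> M m a \<in> gen X" "M m p \<notin> gen X"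
    using Suc.prems(2)[of s m] Suc.hyps(2) by auto
  have card: "m = card (s - {p})"
    using Suc.hyps(2) Suc.prems(1) p by simp
  have remove: "(\<Sum>a\<in>s. c a * M r a) = c p * M r p + (\<Sum>a\<in>s - {p}. c a * M r a)" for c r
    using sum.remove[OF Suc.prems(1) p] by blast
  \<comment> \<open>With a zero at \<open>p\<close>, the first \<open>m\<close> rows restrict to a
    system on \<open>s - {p}\<close> that the induction hypothesis covers.\<close>
  have vanish: "\<forall>a\<in>s. c a = 0" if "c p = 0" "\<And>r. r < m \<Longrightarrow> (\<Sum>a\<in>s. c a * M r a) = 0" for c
  proof -
    have "\<forall>a\<in>s - {p}. c a = 0"
    proof (rule Suc.hyps(1)[OF card])
      show "\<exists>p\<in>s'. \<exists>X. (\<forall>r<n. \<forall>a\<in>s'. M r a \<in> gen X) \<and> (\<forall>a\<in>s' - {p}. M n a \<in> gen X) \<and>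
          M n p \<notin> gen X" if "s' \<subseteq> s - {p}" "card s' = Suc n" for s' n
        using Suc.prems(2)[of s' n] that by blast
      show "(\<Sum>a\<in>s - {p}. c a * M r a) = 0" if "r < card (s - {p})" for r
        using \<open>c p = 0\<close> remove[of c r] \<open>\<And>r. r < m \<Longrightarrow> (\<Sum>a\<in>s. c a * M r a) = 0\<close> that card by simp
    qed (use Suc.prems(1) in simp)
    then show ?thesis
      using that(1) by blast
  qed
  show ?case
  proof (cases "b p = 0")
    case True
    then show ?thesis
      using vanish[of b] zero Suc.hyps(2) by simp
  next
    case False
    \<comment> \<open>The first \<open>m\<close> rows have \<open>m + 1\<close> unknowns, hence a
      nonzero solution over the subfield.\<close>
    have "\<exists>b'. (\<forall>a\<in>s. b' a \<in> gen X) \<and> (\<exists>a\<in>s. b' a \<noteq> 0) \<and>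
        (\<forall>r\<in>{..<m}. (\<Sum>a\<in>s. b' a * M r a) = 0)"
      using X(1) Suc.prems(1) Suc.hyps(2) by (intro underdetermined_system) auto
    then obtain b' where b': "\<And>a. a \<in> s \<Longrightarrow> b' a \<in> gen X" "\<exists>a\<in>s. b' a \<noteq> 0"
      "\<And>r. r < m \<Longrightarrow> (\<Sum>a\<in>s. b' a * M r a) = 0"
      by (auto simp: Ball_def)
    have b'p: "b' p \<noteq> 0"
      using vanish[of b'] b'(2,3) by blast
    \<comment> \<open>Chosen so that \<open>b\<close> minus \<open>c\<close> times \<open>b'\<close>
      is zero at \<open>p\<close>; by \<open>vanish\<close> it is zero everywhere, so
      \<open>b\<close> is a multiple of \<open>b'\<close>.\<close>
    define c where "c = b p / b' p"
    have "\<forall>a\<in>s. b a - c * b' a = 0"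
    proof (rule vanish)
      show "b p - c * b' p = 0"
        using b'p by (simp add: c_def)
      show "(\<Sum>a\<in>s. (b a - c * b' a) * M r a) = 0" if "r < m" for r
      proof -
        have "(\<Sum>a\<in>s. (b a - c * b' a) * M r a) = (\<Sum>a\<in>s. b a * M r a) - c * (\<Sum>a\<in>s. b' a * M r a)"
          by (simp add: algebra_simps sum_subtractf sum_distrib_left)
        then show ?thesis
          using zero[of r] b'(3)[OF that] that Suc.hyps(2) by simp
      qed
    qed
    then have "(\<Sum>a\<in>s. b a * M m a) = c * (\<Sum>a\<in>s. b' a * M m a)"
      unfolding sum_distrib_left by (intro sum.cong) (auto simp: algebra_simps)
    moreover have "c \<noteq> 0"
      using False b'p by (simp add: c_def)
    ultimately have "(\<Sum>a\<in>s. b' a * M m a) = 0"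
      using zero[of m] Suc.hyps(2) by simp
    then have "M m p = - (\<Sum>a\<in>s - {p}. b' a * M m a) / b' p"
      using remove[of b' m] b'p by (simp add: field_simps eq_neg_iff_add_eq_0)
    moreover have "- (\<Sum>a\<in>s - {p}. b' a * M m a) / b' p \<in> gen X"
      using b'(1) X(2) p by (intro gen_divide gen.uminus gen_sum gen.mult) auto
    ultimately show ?thesis
      using X(3) by simp
  qed
qed

section \<open>The generic symmetric matrix\<close>

text \<open>
  The entry at \<open>\<alpha> < \<beta>\<close> is stored as \<open>f (\<beta>, \<alpha>)\<close>, the larger index first, so that the recursion is
  lexicographic in \<open>(\<beta>, \<rho> \<beta> \<alpha>, \<alpha>)\<close>.
\<close>

definition earlier_entries ::
  "('i::wellorder \<Rightarrow> 'i \<Rightarrow> 'l::wellorder) \<Rightarrow> ('f \<Rightarrow> 'l) \<Rightarrow> ('i \<times> 'i \<Rightarrow> 'f) \<Rightarrow> 'i \<Rightarrow> 'i \<Rightarrow> 'f set" where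
  "earlier_entries \<rho> \<psi> f \<beta> \<alpha> = {y. \<psi> y < \<rho> \<beta> \<alpha>} \<union>
     (f ` {(\<eta>, \<xi>). \<xi> < \<eta> \<and> \<eta> < \<beta> \<and> \<rho> \<beta> \<xi> \<le> \<rho> \<beta> \<alpha> \<and> \<rho> \<beta> \<eta> \<le> \<rho> \<beta> \<alpha>} \<union>
      f ` {(\<eta>, \<xi>). \<eta> = \<beta> \<and> \<xi> < \<beta> \<and> (\<rho> \<beta> \<xi> < \<rho> \<beta> \<alpha> \<or> \<rho> \<beta> \<xi> = \<rho> \<beta> \<alpha> \<and> \<xi> < \<alpha>)})"

lemma card_of_earlier_entries:
  fixes \<rho> :: "'i::wellorder \<Rightarrow> 'i \<Rightarrow> 'f card_ord" and \<psi> :: "'f \<Rightarrow> 'f card_ord"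
  assumes unc: "|UNIV :: nat set| <o |UNIV :: 'f set|"
    and small: "small_ranks \<rho>" and \<psi>: "inj \<psi>"
  shows "|earlier_entries \<rho> \<psi> f \<beta> \<alpha>| <o |UNIV :: 'f set|"
proof -
  have inf: "infinite (UNIV :: 'f set)"
    by (rule infinite_iff_card_of_nat[THEN iffD2, OF ordLess_imp_ordLeq[OF unc]])
  obtain M :: "'f card_ord set" where M: "infinite M" "|M| <o |UNIV :: 'f card_ord set|"
    "|{\<gamma>. \<gamma> < \<beta> \<and> \<rho> \<beta> \<gamma> \<le> \<rho> \<beta> \<alpha>}| \<le>o |M|"
    using small unfolding small_ranks_def by blast
  \<comment> \<open>Apart from \<beta> itself, all indices occurring in
    \<open>earlier_entries\<close> come from this small set.\<close>
  define W where "W = {\<gamma>. \<gamma> < \<beta> \<and> \<rho> \<beta> \<gamma> \<le> \<rho> \<beta> \<alpha>}"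
  have M': "|M| <o |UNIV :: 'f set|"
    by (rule ordLess_ordIso_trans[OF M(2) card_of_card_ord])
  have "|{y. \<psi> y < \<rho> \<beta> \<alpha>}| \<le>o |{..<\<rho> \<beta> \<alpha>}|"
    using \<psi> by (intro card_of_ordLeqI[of \<psi>]) (auto simp: inj_on_def)
  then have 1: "|{y. \<psi> y < \<rho> \<beta> \<alpha>}| <o |UNIV :: 'f set|"
    by (rule ordLeq_ordLess_trans[OF _ card_of_lessThan_card_ord])
  have W: "|W| \<le>o |M|"
    using M(3) by (simp add: W_def)
  have WW: "|W \<times> W| \<le>o |M|"
    by (rule card_of_Times_ordLeq_infinite[OF M(1) W W])
  have 2: "|f ` {(\<eta>, \<xi>). \<xi> < \<eta> \<and> \<eta> < \<beta> \<and> \<rho> \<beta> \<xi> \<le> \<rho> \<beta> \<alpha> \<and> \<rho> \<beta> \<eta> \<le> \<rho> \<beta> \<alpha>}| <o |UNIV :: 'f set|"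
  proof (rule ordLeq_ordLess_trans[OF _ M'], rule ordLeq_transitive[OF card_of_image],
      rule ordLeq_transitive[OF card_of_mono1 WW])
    show "{(\<eta>, \<xi>). \<xi> < \<eta> \<and> \<eta> < \<beta> \<and> \<rho> \<beta> \<xi> \<le> \<rho> \<beta> \<alpha> \<and> \<rho> \<beta> \<eta> \<le> \<rho> \<beta> \<alpha>} \<subseteq> W \<times> W"
      by (auto simp: W_def)
  qed
  have 3: "|f ` {(\<eta>, \<xi>). \<eta> = \<beta> \<and> \<xi> < \<beta> \<and> (\<rho> \<beta> \<xi> < \<rho> \<beta> \<alpha> \<or> \<rho> \<beta> \<xi> = \<rho> \<beta> \<alpha> \<and> \<xi> < \<alpha>)}| <o |UNIV :: 'f set|"
  proof (rule ordLeq_ordLess_trans[OF _ M'], rule ordLeq_transitive[OF card_of_image],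
      rule ordLeq_transitive[OF card_of_mono1 ordLeq_transitive[OF card_of_image W]])
    show "{(\<eta>, \<xi>). \<eta> = \<beta> \<and> \<xi> < \<beta> \<and> (\<rho> \<beta> \<xi> < \<rho> \<beta> \<alpha> \<or> \<rho> \<beta> \<xi> = \<rho> \<beta> \<alpha> \<and> \<xi> < \<alpha>)} \<subseteq> Pair \<beta> ` W"
      by (auto simp: W_def)
  qed
  show ?thesis
    unfolding earlier_entries_def by (intro card_of_Un_ordLess_infinite[OF inf] 1 2 3)
qed

text \<open>Each entry listed in \<open>earlier_entries\<close> precedes the current one in the
  well-founded order \<open>lt\<close>, and by cardinality the subfield to be avoided is
  proper.\<close>

lemma generic_matrix_exists:
  fixes \<rho> :: "'i::wellorder \<Rightarrow> 'i \<Rightarrow> 'f::field card_ord" and \<psi> :: "'f \<Rightarrow> 'f card_ord"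
  assumes unc: "|UNIV :: nat set| <o |UNIV :: 'f set|"
    and small: "small_ranks \<rho>" and \<psi>: "inj \<psi>"
  shows "\<exists>f. \<forall>\<beta> \<alpha>. \<alpha> < \<beta> \<longrightarrow> f (\<beta>, \<alpha>) \<notin> gen (earlier_entries \<rho> \<psi> f \<beta> \<alpha>)"
proof -
  define lt :: "(('i \<times> 'i) \<times> ('i \<times> 'i)) set" where
    "lt = inv_image ({(x, y). x < y} <*lex*> {(x, y). x < y} <*lex*> {(x, y). x < y})
      (\<lambda>(\<beta>, \<alpha>). (\<beta>, \<rho> \<beta> \<alpha>, \<alpha>))"
  have "wf lt"
    unfolding lt_def by (intro wf_inv_image wf_lex_prod wf)
  then have "\<exists>f. \<forall>x. case x of (\<beta>, \<alpha>) \<Rightarrow> f x \<notin> gen (earlier_entries \<rho> \<psi> f \<beta> \<alpha>)"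
  proof (rule dependent_wf_choice)
    fix f g :: "'i \<times> 'i \<Rightarrow> 'f" and x :: "'i \<times> 'i" and r
    assume fg: "\<And>z. (z, x) \<in> lt \<Longrightarrow> f z = g z"
    obtain \<beta> \<alpha> where x: "x = (\<beta>, \<alpha>)"
      by fastforce
    have "earlier_entries \<rho> \<psi> f \<beta> \<alpha> = earlier_entries \<rho> \<psi> g \<beta> \<alpha>"
      unfolding earlier_entries_def
      by (intro arg_cong2[of _ _ _ _ "(\<union>)"] refl image_cong) (auto intro!: fg simp: x lt_def)
    then show "(case x of (\<beta>, \<alpha>) \<Rightarrow> r \<notin> gen (earlier_entries \<rho> \<psi> f \<beta> \<alpha>)) =
        (case x of (\<beta>, \<alpha>) \<Rightarrow> r \<notin> gen (earlier_entries \<rho> \<psi> g \<beta> \<alpha>))"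
      by (simp add: x)
  next
    fix x :: "'i \<times> 'i" and f :: "'i \<times> 'i \<Rightarrow> 'f"
    obtain \<beta> \<alpha> where x: "x = (\<beta>, \<alpha>)"
      by fastforce
    have less: "|gen (earlier_entries \<rho> \<psi> f \<beta> \<alpha>)| <o |UNIV :: 'f set|"
      by (rule card_of_gen_less[OF card_of_earlier_entries[OF unc small \<psi>] unc])
    have "gen (earlier_entries \<rho> \<psi> f \<beta> \<alpha>) \<noteq> UNIV"
    proof
      assume "gen (earlier_entries \<rho> \<psi> f \<beta> \<alpha>) = UNIV"
      then show False
        using not_ordLess_ordIso[OF less] card_of_refl[of "UNIV :: 'f set"] by simp
    qed
    then show "\<exists>r. case x of (\<beta>, \<alpha>) \<Rightarrow> r \<notin> gen (earlier_entries \<rho> \<psi> f \<beta> \<alpha>)"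
      by (auto simp: x)
  qed
  then show ?thesis
    by auto
qed

section \<open>Finitely supported functions\<close>

abbreviation lookup where "lookup \<equiv> Poly_Mapping.lookup"
abbreviation keys where "keys \<equiv> Poly_Mapping.keys"

definition scaleF :: "'f::field \<Rightarrow> ('b \<Rightarrow>\<^sub>0 'f) \<Rightarrow> ('b \<Rightarrow>\<^sub>0 'f)" where
  "scaleF c p = Poly_Mapping.map ((*) c) p"

lemma lookup_scaleF [simp]: "lookup (scaleF c p) k = c * lookup p k"
  by (simp add: scaleF_def map.rep_eq when_def)

interpretation F: vector_space scaleF
  by unfold_locales (rule poly_mapping_eqI; simp add: lookup_add algebra_simps)+

lemma lookup_sum: "lookup (sum f A) k = (\<Sum>a\<in>A. lookup (f a) k)"
  by (induction A rule: infinite_finite_induct) (simp_all add: lookup_add)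

definition unit_vectors :: "'b set \<Rightarrow> ('b \<Rightarrow>\<^sub>0 'f::field) set" where
  "unit_vectors S = (\<lambda>k. Poly_Mapping.single k 1) ` S"

lemma card_of_unit_vectors: "|unit_vectors S :: ('b \<Rightarrow>\<^sub>0 'f::field) set| =o |S|"
proof -
  have "inj_on (\<lambda>k. Poly_Mapping.single k (1 :: 'f)) S"
    by (rule inj_onI) (metis lookup_single_eq lookup_single_not_eq zero_neq_one)
  then have "bij_betw (\<lambda>k. Poly_Mapping.single k (1 :: 'f)) S (unit_vectors S)"
    by (simp add: bij_betw_def unit_vectors_def)
  then show ?thesis
    using card_of_ordIsoI ordIso_symmetric by blast
qed

lemma independent_unit_vectors: "F.independent (unit_vectors S :: ('b \<Rightarrow>\<^sub>0 'f::field) set)"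
proof (rule ccontr)
  assume "\<not> ?thesis"
  then obtain t u v where t: "finite t" "t \<subseteq> unit_vectors S" "(\<Sum>w\<in>t. scaleF (u w) w) = 0"
    and v: "v \<in> t" "u v \<noteq> (0 :: 'f)"
    unfolding F.dependent_explicit by blast
  obtain k where k: "v = Poly_Mapping.single k 1"
    using t(2) v(1) by (auto simp: unit_vectors_def)
  have "lookup w k = (if w = v then 1 else 0)" if "w \<in> t" for w
    using that t(2) unfolding k unit_vectors_def
    by (auto simp: lookup_single when_def)
  then have "lookup (\<Sum>w\<in>t. scaleF (u w) w) k = (\<Sum>w\<in>t. if w = v then u w else 0)"
    unfolding lookup_sum by (intro sum.cong) auto
  also have "\<dots> = u v"
    using t(1) v(1) by simp
  finally show False
    using t(3) v(2) by simp
qed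

lemma span_unit_vectors: "F.span (unit_vectors S :: ('b \<Rightarrow>\<^sub>0 'f::field) set) = {p. keys p \<subseteq> S}"
proof
  have "F.subspace {p :: 'b \<Rightarrow>\<^sub>0 'f. keys p \<subseteq> S}"
    unfolding F.subspace_def by (auto simp: in_keys_iff lookup_add subset_iff) (metis add_0_left)
  then show "F.span (unit_vectors S) \<subseteq> {p :: 'b \<Rightarrow>\<^sub>0 'f. keys p \<subseteq> S}"
    by (intro F.span_minimal) (auto simp: unit_vectors_def)
  show "{p :: 'b \<Rightarrow>\<^sub>0 'f. keys p \<subseteq> S} \<subseteq> F.span (unit_vectors S)"
  proof
    fix p :: "'b \<Rightarrow>\<^sub>0 'f"
    assume p: "p \<in> {p. keys p \<subseteq> S}"
    have "p = (\<Sum>k\<in>keys p. scaleF (lookup p k) (Poly_Mapping.single k 1))"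
      by (rule poly_mapping_eqI)
        (auto simp: lookup_sum lookup_single when_def in_keys_iff if_distrib cong: if_cong)
    moreover have "(\<Sum>k\<in>keys p. scaleF (lookup p k) (Poly_Mapping.single k 1)) \<in> F.span (unit_vectors S)"
      using p by (intro F.span_sum F.span_scale F.span_base) (auto simp: unit_vectors_def)
    ultimately show "p \<in> F.span (unit_vectors S)"
      by (rule ssubst)
  qed
qed

section \<open>Dimension counts with cardinals\<close>

lemma (in vector_space) independent_in_span_card:
  assumes "independent B" "independent C" "B \<subseteq> span C"
  shows "|B| \<le>o |C|"
proof -
  obtain B' where B': "B \<subseteq> B'" "B' \<subseteq> span C" "independent B'" "span C \<subseteq> span B'"
    using maximal_independent_subset_extend[OF assms(3,1)] by blast
  have "span C = span B'"
    using B'(2,4) span_mono[OF B'(2)] by (simp add: span_span subset_antisym)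
  then have "|B'| \<le>o |C|"
    by (rule card_of_basis_ordLeq[OF assms(2) B'(3)])
  then show ?thesis
    by (rule ordLeq_transitive[OF card_of_mono1[OF B'(1)]])
qed

lemma (in vector_space) subspace_basis:
  assumes "subspace V"
  shows "\<exists>B. independent B \<and> span B = V \<and> |B| =o cdim scale V"
proof -
  obtain B where B: "B \<subseteq> V" "independent B" "V \<subseteq> span B"
    using basis_exists[of V] by metis
  have "span B = V"
    using B span_minimal[OF B(1) assms] by auto
  then show ?thesis
    using card_of_basis[OF B(2)] B(2) by blast
qed

text \<open>Otherwise the projection to the coordinates in \<open>C\<close> would be injective on
  the span of \<open>B\<close> and would map \<open>B\<close> to an independent set in a space of
  dimension \<open>|C|\<close>.\<close>

lemma combination_vanishing_on:
  fixes B :: "('b \<Rightarrow>\<^sub>0 'f::field) set"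
  assumes B: "F.independent B" and less: "|C| <o |B|"
  shows "\<exists>u\<in>F.span B. u \<noteq> 0 \<and> (\<forall>k\<in>C. lookup u k = 0)"
proof (rule ccontr)
  assume neg: "\<not> ?thesis"
  define \<pi> :: "('b \<Rightarrow>\<^sub>0 'f) \<Rightarrow> ('b \<Rightarrow>\<^sub>0 'f)" where "\<pi> = Poly_Mapping.mapp (\<lambda>k v. if k \<in> C then v else 0)"
  have lookup_\<pi>: "lookup (\<pi> p) k = (if k \<in> C then lookup p k else 0)" for p k
    by (auto simp: \<pi>_def lookup_mapp when_def in_keys_iff)
  interpret \<pi>: Vector_Spaces.linear scaleF scaleF \<pi>
    unfolding Vector_Spaces.linear_iff
    by (auto intro!: F.vector_space_axioms poly_mapping_eqI simp: lookup_\<pi> lookup_add)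
  have "inj_on \<pi> (F.span B)"
  proof (rule inj_onI)
    fix x y
    assume x: "x \<in> F.span B" and y: "y \<in> F.span B" and eq: "\<pi> x = \<pi> y"
    have "lookup (x - y) k = 0" if "k \<in> C" for k
    proof -
      have "lookup (\<pi> x) k = lookup (\<pi> y) k"
        by (simp add: eq)
      then show ?thesis
        using that by (simp add: lookup_\<pi> lookup_minus)
    qed
    then have "x - y = 0"
      using neg F.span_diff[OF x y] by blast
    then show "x = y"
      by simp
  qed
  then have ind: "F.independent (\<pi> ` B)" and inj: "inj_on \<pi> B"
    using \<pi>.independent_injective_image[OF B] inj_on_subset[OF _ F.span_superset] by blast+
  have "\<pi> ` B \<subseteq> F.span (unit_vectors C)"
    unfolding span_unit_vectors by (auto simp: in_keys_iff lookup_\<pi> split: if_splits)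
  then have "|\<pi> ` B| \<le>o |unit_vectors C :: ('b \<Rightarrow>\<^sub>0 'f) set|"
    by (rule F.independent_in_span_card[OF ind independent_unit_vectors])
  then have "|\<pi> ` B| \<le>o |C|"
    by (rule ordLeq_ordIso_trans[OF _ card_of_unit_vectors])
  moreover have "|B| \<le>o |\<pi> ` B|"
    using inj by (intro card_of_ordLeqI[of \<pi>]) auto
  ultimately have "|B| \<le>o |C|"
    using ordLeq_transitive by blast
  then show False
    using not_ordLess_ordLeq[OF less] by blast
qed

section \<open>The form and its orthogonal complements\<close>

text \<open>The support is pulled back along \<iota>, which embeds the ordinal indices into the
  ambient coordinate type; all order arguments take place on the ordinal side.\<close>

definition supp :: "('i \<Rightarrow> 'b) \<Rightarrow> ('b \<Rightarrow>\<^sub>0 'f::zero) \<Rightarrow> 'i set" where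
  "supp \<iota> p = {i. lookup p (\<iota> i) \<noteq> 0}"

text \<open>The diagonal value 0 lies in every generated subfield, which settles the case of equal
  indices in \<open>rows_generic\<close>.\<close>

definition sym_entry :: "('i::linorder \<times> 'i \<Rightarrow> 'f::zero) \<Rightarrow> 'i \<Rightarrow> 'i \<Rightarrow> 'f" where
  "sym_entry f \<alpha> \<beta> = (if \<alpha> < \<beta> then f (\<beta>, \<alpha>) else if \<beta> < \<alpha> then f (\<alpha>, \<beta>) else 0)"

definition form :: "('i::linorder \<Rightarrow> 'b) \<Rightarrow> ('i \<times> 'i \<Rightarrow> 'f::field) \<Rightarrow> ('b \<Rightarrow>\<^sub>0 'f) \<Rightarrow> ('b \<Rightarrow>\<^sub>0 'f) \<Rightarrow> 'f" where
  "form \<iota> f p q = (\<Sum>i\<in>supp \<iota> p. \<Sum>j\<in>supp \<iota> q. lookup p (\<iota> i) * lookup q (\<iota> j) * sym_entry f i j)"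

lemma finite_supp: "inj \<iota> \<Longrightarrow> finite (supp \<iota> p)"
  using finite_vimageI[of "keys p" \<iota>] by (simp add: supp_def vimage_def in_keys_iff)

lemma sym_entry_commute: "sym_entry f \<alpha> \<beta> = sym_entry f \<beta> \<alpha>"
  by (auto simp: sym_entry_def)

lemma form_commute: "form \<iota> f p q = form \<iota> f q p"
  unfolding form_def by (subst sum.swap) (simp add: sym_entry_commute[of f] mult.commute)

lemma form_eq:
  assumes "finite A" "supp \<iota> p \<subseteq> A" "finite B" "supp \<iota> q \<subseteq> B"
  shows "form \<iota> f p q = (\<Sum>i\<in>A. \<Sum>j\<in>B. lookup p (\<iota> i) * lookup q (\<iota> j) * sym_entry f i j)"
proof -
  have "form \<iota> f p q = (\<Sum>i\<in>supp \<iota> p. \<Sum>j\<in>B. lookup p (\<iota> i) * lookup q (\<iota> j) * sym_entry f i j)"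
    unfolding form_def using assms(3,4)
    by (intro sum.cong refl sum.mono_neutral_left) (auto simp: supp_def)
  also have "\<dots> = (\<Sum>i\<in>A. \<Sum>j\<in>B. lookup p (\<iota> i) * lookup q (\<iota> j) * sym_entry f i j)"
    using assms(1,2) by (intro sum.mono_neutral_left) (auto simp: supp_def)
  finally show ?thesis .
qed

lemma form_add_left:
  assumes "inj \<iota>"
  shows "form \<iota> f (p + q) r = form \<iota> f p r + form \<iota> f q r"
proof -
  let ?A = "supp \<iota> p \<union> supp \<iota> q"
  have fin: "finite ?A" "finite (supp \<iota> r)"
    using finite_supp[OF assms] by auto
  have "form \<iota> f x r = (\<Sum>i\<in>?A. \<Sum>j\<in>supp \<iota> r. lookup x (\<iota> i) * lookup r (\<iota> j) * sym_entry f i j)"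
    if "supp \<iota> x \<subseteq> ?A" for x
    by (rule form_eq[OF fin(1) that fin(2) subset_refl])
  moreover have "supp \<iota> (p + q) \<subseteq> ?A" "supp \<iota> p \<subseteq> ?A" "supp \<iota> q \<subseteq> ?A"
    by (auto simp: supp_def lookup_add)
  ultimately show ?thesis
    by (simp add: lookup_add algebra_simps sum.distrib)
qed

lemma form_scale_left:
  assumes "inj \<iota>"
  shows "form \<iota> f (scaleF c p) q = c * form \<iota> f p q"
proof -
  have "form \<iota> f (scaleF c p) q =
      (\<Sum>i\<in>supp \<iota> p. \<Sum>j\<in>supp \<iota> q. lookup (scaleF c p) (\<iota> i) * lookup q (\<iota> j) * sym_entry f i j)"
    using finite_supp[OF assms] by (intro form_eq) (auto simp: supp_def)
  then show ?thesis
    by (simp add: form_def sum_distrib_left mult.assoc)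
qed

lemma bilinear_form: "inj \<iota> \<Longrightarrow> bilinear_on scaleF E (form \<iota> f)"
  unfolding bilinear_on_def
  using form_add_left[of \<iota> f] form_scale_left[of \<iota> f] form_commute[of \<iota> f] by metis

lemma subspace_orth:
  assumes "inj \<iota>" "F.subspace E"
  shows "F.subspace (orth E (form \<iota> f) U)"
proof -
  have "form \<iota> f 0 y = 0" for y
    by (simp add: form_def supp_def)
  then show ?thesis
    using assms(2) form_add_left[OF assms(1), of f] form_scale_left[OF assms(1), of f]
    unfolding orth_def F.subspace_def by auto
qed

text \<open>\<open>M r \<alpha>\<close> is the form applied to \<open>x r\<close> and the basis
  vector with index \<alpha>. All ranks at \<open>b m\<close> of other support indices are at most
  \<open>d\<close>, while those of \<open>s\<close> exceed \<open>d\<close>. Hence the entry at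
  (\<open>b m\<close>, \<open>p\<close>) was chosen generic over the coefficients and all other
  entries involved.\<close>

lemma rows_generic:
  fixes \<rho> :: "'i::wellorder \<Rightarrow> 'i \<Rightarrow> 'l::wellorder" and \<psi> :: "'f::field \<Rightarrow> 'l" and x :: "nat \<Rightarrow> 'b \<Rightarrow>\<^sub>0 'f"
  assumes \<iota>: "inj \<iota>"
    and f: "\<And>\<alpha> \<beta>. \<alpha> < \<beta> \<Longrightarrow> f (\<beta>, \<alpha>) \<notin> gen (earlier_entries \<rho> \<psi> f \<beta> \<alpha>)"
    and b: "strict_mono b"
    and top: "\<And>m. b m \<in> supp \<iota> (x m)" "\<And>m \<gamma>. \<gamma> \<in> supp \<iota> (x m) \<Longrightarrow> \<gamma> \<le> b m"
    and rank: "\<And>m r \<gamma>. r \<le> m \<Longrightarrow> \<gamma> \<in> supp \<iota> (x r) \<Longrightarrow> \<gamma> \<noteq> b m \<Longrightarrow> \<rho> (b m) \<gamma> \<le> d"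
    and coef: "\<And>m \<gamma>. \<gamma> \<in> supp \<iota> (x m) \<Longrightarrow> \<psi> (lookup (x m) (\<iota> \<gamma>)) \<le> d"
    and s: "finite s" "\<And>m \<alpha>. \<alpha> \<in> s \<Longrightarrow> \<alpha> < b m" "\<And>m \<alpha>. \<alpha> \<in> s \<Longrightarrow> d < \<rho> (b m) \<alpha>"
    and M: "\<And>r \<alpha>. M r \<alpha> = (\<Sum>\<gamma>\<in>supp \<iota> (x r). lookup (x r) (\<iota> \<gamma>) * sym_entry f \<gamma> \<alpha>)"
    and s': "s' \<subseteq> s" "card s' = Suc m"
  shows "\<exists>p\<in>s'. \<exists>X. (\<forall>r<m. \<forall>a\<in>s'. M r a \<in> gen X) \<and> (\<forall>a\<in>s' - {p}. M m a \<in> gen X) \<and> M m p \<notin> gen X"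
proof -
  define \<beta> where "\<beta> = b m"
  have fin: "finite s'" "s' \<noteq> {}"
    using s' s(1) finite_subset by auto
  \<comment> \<open>Among the entries of row \<beta> at \<open>s'\<close>, the one at
    \<open>p\<close> is chosen last in the recursion: maximal rank first, then maximal
    index.\<close>
  define t where "t = Max (\<rho> \<beta> ` s')"
  define p where "p = Max {\<alpha>\<in>s'. \<rho> \<beta> \<alpha> = t}"
  have "t \<in> \<rho> \<beta> ` s'"
    unfolding t_def using fin by (intro Max_in) auto
  then have "p \<in> {\<alpha>\<in>s'. \<rho> \<beta> \<alpha> = t}"
    unfolding p_def using fin by (intro Max_in) auto
  then have p: "p \<in> s'" "\<rho> \<beta> p = t"
    by auto
  have le_t: "\<rho> \<beta> \<alpha> \<le> t" if "\<alpha> \<in> s'" for \<alpha>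
    unfolding t_def using fin that by (intro Max_ge) auto
  have le_p: "\<alpha> \<le> p" if "\<alpha> \<in> s'" "\<rho> \<beta> \<alpha> = t" for \<alpha>
    unfolding p_def using fin that by (intro Max_ge) auto
  have d: "d < t"
    using s(3)[of p m] p s'(1) by (auto simp: \<beta>_def)
  have s'_less: "\<alpha> < \<beta>" if "\<alpha> \<in> s'" for \<alpha>
    using s(2) that s'(1) by (auto simp: \<beta>_def)
  define X where "X = earlier_entries \<rho> \<psi> f \<beta> p"
  have coef_X: "lookup (x r) (\<iota> \<gamma>) \<in> gen X" if "\<gamma> \<in> supp \<iota> (x r)" for r \<gamma>
    using coef[OF that] d p(2) by (intro gen.base) (auto simp: X_def earlier_entries_def)
  have entry_X: "sym_entry f \<gamma> \<alpha> \<in> gen X"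
    if "\<alpha> \<in> s'" "r \<le> m" "\<gamma> \<in> supp \<iota> (x r)" "\<gamma> \<noteq> \<beta>" for \<alpha> \<gamma> r
  proof -
    have "\<rho> \<beta> \<gamma> \<le> t"
      using rank[OF that(2,3)] that(4) d unfolding \<beta>_def by (meson less_imp_le order_trans)
    moreover have "\<gamma> < \<beta>"
    proof -
      have "\<gamma> \<le> b r"
        by (rule top(2)[OF that(3)])
      also have "b r \<le> \<beta>"
        using b that(2) by (simp add: \<beta>_def strict_mono_less_eq)
      finally show ?thesis
        using that(4) by simp
    qed
    ultimately have "\<gamma> = \<alpha> \<or> (max \<gamma> \<alpha>, min \<gamma> \<alpha>) \<in>
        {(\<eta>, \<xi>). \<xi> < \<eta> \<and> \<eta> < \<beta> \<and> \<rho> \<beta> \<xi> \<le> \<rho> \<beta> p \<and> \<rho> \<beta> \<eta> \<le> \<rho> \<beta> p}"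
      using le_t[OF that(1)] s'_less[OF that(1)] p(2) by (auto simp: max_def min_def)
    then have "\<gamma> = \<alpha> \<or> f (max \<gamma> \<alpha>, min \<gamma> \<alpha>) \<in> X"
      unfolding X_def earlier_entries_def by blast
    then show ?thesis
      unfolding sym_entry_def using gen.zero gen.base[of _ X]
      by (cases \<gamma> \<alpha> rule: linorder_cases) (auto simp: max_def min_def less_imp_le split: if_splits)
  qed
  \<comment> \<open>The top indices increase strictly, so the earlier vectors do not involve \<beta>
    at all.\<close>
  have earlier_rows: "M r \<alpha> \<in> gen X" if "r < m" "\<alpha> \<in> s'" for r \<alpha>
  proof -
    have "\<gamma> \<noteq> \<beta>" if "\<gamma> \<in> supp \<iota> (x r)" for \<gamma>
      using top(2)[OF that] strict_monoD[OF b \<open>r < m\<close>] by (auto simp: \<beta>_def)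
    then show ?thesis
      unfolding M using that by (intro gen_sum gen.mult coef_X entry_X) auto
  qed
  \<comment> \<open>Isolates the contribution of the top index; the remaining sum lies in
    \<open>gen X\<close>, and the coefficient of \<open>f (\<beta>, \<alpha>)\<close> is
    nonzero.\<close>
  have split: "M m \<alpha> = lookup (x m) (\<iota> \<beta>) * f (\<beta>, \<alpha>) +
      (\<Sum>\<gamma>\<in>supp \<iota> (x m) - {\<beta>}. lookup (x m) (\<iota> \<gamma>) * sym_entry f \<gamma> \<alpha>)" if "\<alpha> \<in> s'" for \<alpha>
  proof -
    have "sym_entry f \<beta> \<alpha> = f (\<beta>, \<alpha>)"
      using s'_less[OF that] by (auto simp: sym_entry_def)
    then show ?thesis
      using sum.remove[OF finite_supp[OF \<iota>] top(1)[of m], of "\<lambda>\<gamma>. lookup (x m) (\<iota> \<gamma>) * sym_entry f \<gamma> \<alpha>"]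
      by (simp add: M \<beta>_def)
  qed
  have rest: "(\<Sum>\<gamma>\<in>supp \<iota> (x m) - {\<beta>}. lookup (x m) (\<iota> \<gamma>) * sym_entry f \<gamma> \<alpha>) \<in> gen X"
    if "\<alpha> \<in> s'" for \<alpha>
    using that by (intro gen_sum gen.mult coef_X entry_X[of _ m]) auto
  have c: "lookup (x m) (\<iota> \<beta>) \<in> gen X" "lookup (x m) (\<iota> \<beta>) \<noteq> 0"
    using coef_X[OF top(1)] top(1)[of m] by (auto simp: \<beta>_def supp_def)
  have last_row: "M m \<alpha> \<in> gen X" if "\<alpha> \<in> s' - {p}" for \<alpha>
  proof -
    have "\<rho> \<beta> \<alpha> < \<rho> \<beta> p \<or> \<rho> \<beta> \<alpha> = \<rho> \<beta> p \<and> \<alpha> < p"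
      using le_t[of \<alpha>] le_p[of \<alpha>] that p(2) by auto
    then have "f (\<beta>, \<alpha>) \<in> X"
      unfolding X_def earlier_entries_def using s'_less[of \<alpha>] that by blast
    then show ?thesis
      using split[of \<alpha>] rest[of \<alpha>] c(1) that by (auto intro: gen.add gen.mult gen.base)
  qed
  have "M m p \<notin> gen X"
  proof
    assume "M m p \<in> gen X"
    then have "(M m p - (\<Sum>\<gamma>\<in>supp \<iota> (x m) - {\<beta>}. lookup (x m) (\<iota> \<gamma>) * sym_entry f \<gamma> p)) /
        lookup (x m) (\<iota> \<beta>) \<in> gen X"
      by (intro gen_divide gen_diff rest p c)
    then have "f (\<beta>, p) \<in> gen X"
      using split[OF p(1)] c(2) by simp
    then show False
      using f[OF s'_less[OF p(1)]] by (simp add: X_def)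
  qed
  then show ?thesis
    using p(1) earlier_rows last_row by blast
qed

text \<open>The top indices of vectors in \<open>V\<close> are unbounded. Regularity first fixes a
  common bound on the coefficients of the vectors over an unbounded set of tops, and
  \<open>chain_ranks\<close> then supplies the sequence.\<close>

lemma unbounded_chain:
  fixes \<rho> :: "'f::field suc \<Rightarrow> 'f suc \<Rightarrow> 'f card_ord" and V :: "('b \<Rightarrow>\<^sub>0 'f::field) set"
    and \<psi> :: "'f \<Rightarrow> 'f card_ord"
  assumes inf: "infinite (UNIV :: 'f set)" and \<iota>: "inj \<iota>" and \<rho>: "chain_ranks \<rho>"
    and V: "\<And>\<delta>. \<exists>x\<in>V. \<exists>i\<in>supp \<iota> x. \<delta> < i"
  shows "\<exists>b (x :: nat \<Rightarrow> 'b \<Rightarrow>\<^sub>0 'f) d. strict_mono b \<and> range x \<subseteq> V \<and> \<delta> < b 0 \<and>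
    (\<forall>m. b m \<in> supp \<iota> (x m) \<and> (\<forall>\<gamma>\<in>supp \<iota> (x m). \<gamma> \<le> b m)) \<and>
    (\<forall>r m. \<forall>\<gamma>\<in>supp \<iota> (x r). r \<le> m \<longrightarrow> \<gamma> \<noteq> b m \<longrightarrow> \<rho> (b m) \<gamma> \<le> d) \<and>
    (\<forall>m. \<forall>\<gamma>\<in>supp \<iota> (x m). \<psi> (lookup (x m) (\<iota> \<gamma>)) \<le> d)"
proof -
  define is_top where "is_top x b \<longleftrightarrow> x \<in> V \<and> b \<in> supp \<iota> x \<and> (\<forall>\<gamma>\<in>supp \<iota> x. \<gamma> \<le> b)" for x b
  define B where "B = {b. \<delta> < b \<and> (\<exists>x. is_top x b)}"
  have B: "\<exists>b\<in>B. \<epsilon> < b" for \<epsilon>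
  proof -
    obtain x i where x: "x \<in> V" "i \<in> supp \<iota> x" "max \<delta> \<epsilon> < i"
      using V by blast
    have fin: "finite (supp \<iota> x)"
      by (rule finite_supp[OF \<iota>])
    have "i \<le> Max (supp \<iota> x)"
      using fin x(2) by simp
    moreover have "is_top x (Max (supp \<iota> x))"
      unfolding is_top_def using fin x(1,2) by (auto intro: Max_in)
    ultimately show ?thesis
      using x(3) unfolding B_def by (intro bexI[of _ "Max (supp \<iota> x)"]) auto
  qed
  define xs where "xs b = (SOME x. is_top x b)" for b
  have xs: "is_top (xs b) b" if "b \<in> B" for b
    using that unfolding B_def xs_def by (auto intro: someI_ex)
  define e where "e b = Max ((\<lambda>\<gamma>. \<psi> (lookup (xs b) (\<iota> \<gamma>))) ` supp \<iota> (xs b))" for b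
  have e: "\<psi> (lookup (xs b) (\<iota> \<gamma>)) \<le> e b" if "\<gamma> \<in> supp \<iota> (xs b)" for b \<gamma>
    unfolding e_def using that finite_supp[OF \<iota>] by (intro Max_ge) auto
  have "\<exists>k. \<forall>\<epsilon>. \<exists>b\<in>B. \<epsilon> < b \<and> e b = k"
  proof (rule unbounded_part)
    show "\<exists>b. \<forall>k. g k < b" for g :: "'f card_ord \<Rightarrow> 'f suc"
    proof -
      have "|range g| \<le>o |UNIV :: 'f set|"
        by (rule ordLeq_ordIso_trans[OF card_of_image card_of_card_ord])
      from bounded_suc[OF inf this] show ?thesis
        by auto
    qed
  qed (rule B)
  then obtain k where k: "\<And>\<epsilon>. \<exists>b\<in>{b\<in>B. e b = k}. \<epsilon> < b"
    by blast
  \<comment> \<open>The top is removed because \<open>chain_ranks\<close> speaks of sets strictly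
    below \<open>b\<close>.\<close>
  define s where "s b = supp \<iota> (xs b) - {b}" for b
  have s: "finite (s b) \<and> s b \<subseteq> {..<b}" if "b \<in> B" for b
    using xs[OF that] finite_supp[OF \<iota>] unfolding s_def is_top_def by (auto simp: order_le_less)
  have "\<exists>(b :: nat \<Rightarrow> 'f suc) d. strict_mono b \<and> range b \<subseteq> {b\<in>B. e b = k} \<and>
      (\<forall>m. \<forall>\<gamma>\<in>s (b m) \<union> (\<Union>r<m. insert (b r) (s (b r))). \<rho> (b m) \<gamma> \<le> d)"
    using \<rho>[unfolded chain_ranks_def, rule_format, of "{b\<in>B. e b = k}" s] k s by simp
  then obtain b :: "nat \<Rightarrow> 'f suc" and d where bd: "strict_mono b \<and> range b \<subseteq> {b\<in>B. e b = k} \<and>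
      (\<forall>m. \<forall>\<gamma>\<in>s (b m) \<union> (\<Union>r<m. insert (b r) (s (b r))). \<rho> (b m) \<gamma> \<le> d)"
    by (elim exE)
  then have b: "strict_mono b" "range b \<subseteq> {b\<in>B. e b = k}"
    by simp_all
  have d: "\<rho> (b m) \<gamma> \<le> d" if "\<gamma> \<in> s (b m) \<union> (\<Union>r<m. insert (b r) (s (b r)))" for m \<gamma>
    using bd that by simp
  have bB: "b m \<in> B" "e (b m) = k" for m
    using b(2) by auto
  define x where "x m = xs (b m)" for m
  have top: "x m \<in> V" "b m \<in> supp \<iota> (x m)" "\<forall>\<gamma>\<in>supp \<iota> (x m). \<gamma> \<le> b m" for m
    using xs[OF bB(1), of m] unfolding x_def is_top_def by auto
  have "\<rho> (b m) \<gamma> \<le> max d k" if "\<gamma> \<in> supp \<iota> (x r)" "r \<le> m" "\<gamma> \<noteq> b m" for r m \<gamma>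
  proof -
    have "\<gamma> \<in> insert (b r) (s (b r))"
      using that(1) by (auto simp: s_def x_def)
    then have "\<gamma> \<in> s (b m) \<union> (\<Union>r<m. insert (b r) (s (b r)))"
      using that(2,3) by (cases "r = m") auto
    then show ?thesis
      using d by (simp add: le_max_iff_disj)
  qed
  moreover have "\<psi> (lookup (x m) (\<iota> \<gamma>)) \<le> max d k" if "\<gamma> \<in> supp \<iota> (x m)" for m \<gamma>
    using e[of \<gamma> "b m"] that bB(2)[of m] unfolding x_def by (simp add: le_max_iff_disj)
  moreover have "\<delta> < b 0"
    using bB(1)[of 0] by (simp add: B_def)
  ultimately show ?thesis
    using b(1) top by (intro exI[of _ b] exI[of _ x] exI[of _ "max d k"]) auto
qed

section \<open>The Gross space of dimension lambda^+\<close>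

lemma gross_space_of_suc_dimension:
  fixes \<iota> :: "'f::field suc \<Rightarrow> 'b"
  assumes unc: "|UNIV :: nat set| <o |UNIV :: 'f set|" and \<iota>: "inj \<iota>"
  shows "\<exists>E \<Phi>. gross_space (scaleF :: 'f \<Rightarrow> ('b \<Rightarrow>\<^sub>0 'f) \<Rightarrow> _) |UNIV :: 'f set| E \<Phi> \<and>
    cdim (scaleF :: 'f \<Rightarrow> ('b \<Rightarrow>\<^sub>0 'f) \<Rightarrow> _) E =o |UNIV :: 'f suc set|"
proof -
  have inf: "infinite (UNIV :: 'f set)"
    by (rule infinite_iff_card_of_nat[THEN iffD2, OF ordLess_imp_ordLeq[OF unc]])
  obtain \<rho> :: "'f suc \<Rightarrow> 'f suc \<Rightarrow> 'f card_ord" where \<rho>: "small_ranks \<rho>" "chain_ranks \<rho>"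
    using ranks_exist[OF unc] by blast
  obtain \<psi> :: "'f \<Rightarrow> 'f card_ord" where \<psi>: "inj \<psi>"
    using ordIso_imp_ordLeq[OF ordIso_symmetric[OF card_of_card_ord]]
      card_of_ordLeq[of "UNIV :: 'f set" "UNIV :: 'f card_ord set"] by blast
  obtain f where f: "\<And>\<alpha> \<beta>. \<alpha> < \<beta> \<Longrightarrow> f (\<beta>, \<alpha>) \<notin> gen (earlier_entries \<rho> \<psi> f \<beta> \<alpha>)"
    using generic_matrix_exists[OF unc \<rho>(1) \<psi>] by blast
  define E :: "('b \<Rightarrow>\<^sub>0 'f) set" where "E = F.span (unit_vectors (range \<iota>))"
  define \<Phi> where "\<Phi> = form \<iota> f"
  have E_eq: "E = {p. keys p \<subseteq> range \<iota>}"
    by (simp add: E_def span_unit_vectors)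
  have dimE: "|UNIV :: 'f suc set| =o cdim scaleF E"
  proof -
    have "|UNIV :: 'f suc set| =o |range \<iota>|"
      using \<iota> by (intro card_of_ordIsoI[of \<iota>]) (simp add: bij_betw_def)
    moreover have "|range \<iota>| =o |unit_vectors (range \<iota>) :: ('b \<Rightarrow>\<^sub>0 'f) set|"
      by (rule ordIso_symmetric[OF card_of_unit_vectors])
    moreover have "|unit_vectors (range \<iota>) :: ('b \<Rightarrow>\<^sub>0 'f) set| =o cdim scaleF E"
      unfolding E_def by (rule F.card_of_basis[OF independent_unit_vectors refl])
    ultimately show ?thesis
      by (rule ordIso_transitive[OF _ ordIso_transitive])
  qed
  have subE: "F.subspace E"
    by (simp add: E_def)
  have "cdim scaleF (orth E \<Phi> U) <o cdim scaleF E"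
    if U: "F.subspace U" "U \<subseteq> E" "|UNIV :: 'f set| \<le>o cdim scaleF U" for U
  proof (rule ccontr)
    assume large: "\<not> cdim scaleF (orth E \<Phi> U) <o cdim scaleF E"
    define V where "V = orth E \<Phi> U"
    \<comment> \<open>If all supports stayed at or below \<delta>, the complement would lie in the
      span of at most lambda unit vectors and have dimension below lambda^+.\<close>
    have V: "\<exists>x\<in>V. \<exists>i\<in>supp \<iota> x. \<delta> < i" for \<delta>
    proof (rule ccontr)
      assume neg: "\<not> ?thesis"
      have subV: "F.subspace V"
        unfolding V_def \<Phi>_def by (rule subspace_orth[OF \<iota> subE])
      have "V \<subseteq> F.span (unit_vectors (\<iota> ` {..\<delta>}))"
      proof
        fix x
        assume x: "x \<in> V"
        then have "keys x \<subseteq> range \<iota>"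
          by (simp add: V_def orth_def E_eq)
        moreover have "i \<le> \<delta>" if "\<iota> i \<in> keys x" for i
          using neg x that by (auto simp: supp_def in_keys_iff not_less)
        ultimately show "x \<in> F.span (unit_vectors (\<iota> ` {..\<delta>}))"
          unfolding span_unit_vectors by blast
      qed
      moreover obtain A where A: "F.independent A" "F.span A = V" "|A| =o cdim scaleF V"
        using F.subspace_basis[OF subV] by blast
      ultimately have "A \<subseteq> F.span (unit_vectors (\<iota> ` {..\<delta>}))"
        using F.span_superset by blast
      then have "|A| \<le>o |unit_vectors (\<iota> ` {..\<delta>}) :: ('b \<Rightarrow>\<^sub>0 'f) set|"
        by (rule F.independent_in_span_card[OF A(1) independent_unit_vectors])
      then have "|A| \<le>o |\<iota> ` {..\<delta>}|"
        by (rule ordLeq_ordIso_trans[OF _ card_of_unit_vectors])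
      then have "|A| \<le>o |{..\<delta>}|"
        by (rule ordLeq_transitive[OF _ card_of_image])
      then have "|A| \<le>o |UNIV :: 'f set|"
        by (rule ordLeq_transitive[OF _ card_of_atMost_suc[OF inf]])
      then have "cdim scaleF V \<le>o |UNIV :: 'f set|"
        by (rule ordIso_ordLeq_trans[OF ordIso_symmetric[OF A(3)]])
      then have "cdim scaleF V <o |UNIV :: 'f suc set|"
        by (rule ordLeq_ordLess_trans[OF _ card_of_suc_greater])
      then have "cdim scaleF V <o cdim scaleF E"
        by (rule ordLess_ordIso_trans[OF _ dimE])
      then show False
        using large by (simp add: V_def)
    qed
    obtain A where A: "F.independent A" "F.span A = U" "|A| =o cdim scaleF U"
      using F.subspace_basis[OF U(1)] by blast
    have "|UNIV :: 'f set| \<le>o |A|"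
      by (rule ordLeq_ordIso_trans[OF U(3) ordIso_symmetric[OF A(3)]])
    \<comment> \<open>Exactly lambda independent vectors of \<open>U\<close> are kept, so that their
      supports have a common bound below lambda^+.\<close>
    then obtain h :: "'f \<Rightarrow> 'b \<Rightarrow>\<^sub>0 'f" where h: "inj h" "range h \<subseteq> A"
      using card_of_ordLeq[of "UNIV :: 'f set" A] by blast
    have ind_h: "F.independent (range h)"
      by (rule F.independent_mono[OF A(1) h(2)])
    have span_h: "F.span (range h) \<subseteq> U"
      using F.span_mono[OF h(2)] A(2) by simp
    have "|\<Union>y. supp \<iota> (h y)| \<le>o |UNIV :: 'f set|"
      by (intro card_of_UNION_ordLeq_infinite[OF inf] card_of_mono1 subset_refl ballI
          card_of_finite_ordLeq_infinite[OF inf] finite_supp[OF \<iota>])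
    from bounded_suc[OF inf this] obtain \<delta> where \<delta>: "\<And>y i. i \<in> supp \<iota> (h y) \<Longrightarrow> i < \<delta>"
      by blast
    have "h y \<in> {p. keys p \<subseteq> \<iota> ` {..<\<delta>}}" for y
    proof -
      have "h y \<in> E"
        using h(2) A(2) U(2) F.span_superset by blast
      then show ?thesis
        using \<delta>[of _ y] by (auto simp: E_eq supp_def in_keys_iff)
    qed
    then have span_\<delta>: "F.span (range h) \<subseteq> {p. keys p \<subseteq> \<iota> ` {..<\<delta>}}"
      unfolding span_unit_vectors[symmetric] by (intro F.span_minimal F.subspace_span) auto
    obtain b :: "nat \<Rightarrow> 'f suc" and x :: "nat \<Rightarrow> 'b \<Rightarrow>\<^sub>0 'f" and d where b: "strict_mono b" and x: "range x \<subseteq> V"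
      and b0: "\<delta> < b 0"
      and top: "\<forall>m. b m \<in> supp \<iota> (x m) \<and> (\<forall>\<gamma>\<in>supp \<iota> (x m). \<gamma> \<le> b m)"
      and rank: "\<forall>r m. \<forall>\<gamma>\<in>supp \<iota> (x r). r \<le> m \<longrightarrow> \<gamma> \<noteq> b m \<longrightarrow> \<rho> (b m) \<gamma> \<le> d"
      and coef: "\<forall>m. \<forall>\<gamma>\<in>supp \<iota> (x m). \<psi> (lookup (x m) (\<iota> \<gamma>)) \<le> d"
      using unbounded_chain[OF inf \<iota> \<rho>(2) V, of \<delta> \<psi>] by blast
    obtain M :: "'f card_ord set" where M: "infinite M" "|M| <o |UNIV :: 'f card_ord set|"
      "\<And>\<beta>. |{\<gamma>. \<gamma> < \<beta> \<and> \<rho> \<beta> \<gamma> \<le> d}| \<le>o |M|"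
      using \<rho>(1) unfolding small_ranks_def by blast
    \<comment> \<open>The indices on which genericity could fail for some row. The bound
      \<open>M\<close> holds for every \<open>b m\<close> at once, so the countable union is still
      smaller than lambda and some nonzero \<open>u\<close> avoids it.\<close>
    define bad where "bad = (\<Union>m. {\<gamma>. \<gamma> < b m \<and> \<rho> (b m) \<gamma> \<le> d})"
    have "|bad| \<le>o |M|"
      unfolding bad_def using M(1) infinite_iff_card_of_nat
      by (intro card_of_UNION_ordLeq_infinite[OF M(1)] ballI M(3)) auto
    then have "|bad| <o |UNIV :: 'f card_ord set|"
      by (rule ordLeq_ordLess_trans[OF _ M(2)])
    then have "|bad| <o |UNIV :: 'f set|"
      by (rule ordLess_ordIso_trans[OF _ card_of_card_ord])
    then have "|\<iota> ` bad| <o |UNIV :: 'f set|"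
      by (rule ordLeq_ordLess_trans[OF card_of_image])
    moreover have "|UNIV :: 'f set| \<le>o |range h|"
      using h(1) by (intro card_of_ordLeqI[of h]) auto
    ultimately have "|\<iota> ` bad| <o |range h|"
      by (rule ordLess_ordLeq_trans)
    from combination_vanishing_on[OF ind_h this]
    obtain u where u: "u \<in> F.span (range h)" "u \<noteq> 0" "\<And>\<alpha>. \<alpha> \<in> bad \<Longrightarrow> lookup u (\<iota> \<alpha>) = 0"
      by blast
    define s where "s = supp \<iota> u"
    have fin_s: "finite s"
      unfolding s_def by (rule finite_supp[OF \<iota>])
    have keys_u: "keys u \<subseteq> \<iota> ` {..<\<delta>}"
      using u(1) span_\<delta> by blast
    have s_less: "\<alpha> < b m" if "\<alpha> \<in> s" for \<alpha> m
    proof -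
      have "\<iota> \<alpha> \<in> \<iota> ` {..<\<delta>}"
        using that keys_u by (auto simp: s_def supp_def in_keys_iff)
      then have "\<alpha> < \<delta>"
        using \<iota> by (simp add: inj_image_mem_iff)
      also have "\<delta> < b 0"
        by (rule b0)
      also have "b 0 \<le> b m"
        using b by (simp add: strict_mono_less_eq)
      finally show ?thesis .
    qed
    have s_rank: "d < \<rho> (b m) \<alpha>" if "\<alpha> \<in> s" for \<alpha> m
    proof -
      have "\<alpha> \<notin> bad"
        using u(3) that by (auto simp: s_def supp_def)
      then show ?thesis
        using s_less[OF that, of m] by (auto simp: bad_def not_le)
    qed
    define row where "row r \<alpha> = (\<Sum>\<gamma>\<in>supp \<iota> (x r). lookup (x r) (\<iota> \<gamma>) * sym_entry f \<gamma> \<alpha>)" for r \<alpha>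
    have "\<forall>\<alpha>\<in>s. lookup u (\<iota> \<alpha>) = 0"
    proof (rule generic_rows_injective[OF fin_s])
      show "\<exists>p\<in>s'. \<exists>X. (\<forall>r<m. \<forall>a\<in>s'. row r a \<in> gen X) \<and> (\<forall>a\<in>s' - {p}. row m a \<in> gen X) \<and>
          row m p \<notin> gen X" if "s' \<subseteq> s" "card s' = Suc m" for s' m
        by (rule rows_generic[OF \<iota> f b _ _ _ _ fin_s s_less s_rank row_def that])
          (use top rank coef in auto)
      \<comment> \<open>Orthogonality of \<open>x r\<close> and \<open>u\<close>, expanded along the
        coordinates of \<open>u\<close>, is the \<open>r\<close>-th equation of the system.\<close>
      show "(\<Sum>\<alpha>\<in>s. lookup u (\<iota> \<alpha>) * row r \<alpha>) = 0" for r
      proof -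
        have "form \<iota> f (x r) u = 0"
          using x u(1) span_h unfolding V_def orth_def \<Phi>_def by auto
        moreover have "form \<iota> f (x r) u = (\<Sum>\<alpha>\<in>s. lookup u (\<iota> \<alpha>) * row r \<alpha>)"
          unfolding form_def s_def row_def
          by (subst sum.swap) (simp add: sum_distrib_left mult_ac)
        ultimately show ?thesis
          by simp
      qed
    qed
    then have u_zero: "lookup u (\<iota> \<alpha>) = 0" for \<alpha>
      by (auto simp: s_def supp_def)
    have "k \<notin> keys u" for k
    proof
      assume k: "k \<in> keys u"
      then obtain \<alpha> where "k = \<iota> \<alpha>"
        using keys_u by blast
      then show False
        using k u_zero by (simp add: in_keys_iff)
    qed
    then have "keys u = {}"
      by blast
    then show False
      using u(2) by simp
  qed
  then have "gross_space scaleF |UNIV :: 'f set| E \<Phi>"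
    unfolding gross_space_def symmetric_on_def \<Phi>_def
    using subE bilinear_form[OF \<iota>] form_commute by blast
  then show ?thesis
    using ordIso_symmetric[OF dimE] by blast
qed

theorem theorem5:
  fixes \<kappa> :: "'c rel"
  assumes "Card_order \<kappa>" and "natLeq <o \<kappa>"
    and "|UNIV :: 'f::field set| =o \<kappa>"
  shows "\<exists>(scale :: 'f \<Rightarrow> ('c set \<Rightarrow>\<^sub>0 'f) \<Rightarrow> ('c set \<Rightarrow>\<^sub>0 'f)) E \<Phi>.
    vector_space scale \<and>
    gross_space scale \<kappa> E \<Phi> \<and>
    cdim scale E =o cardSuc \<kappa>"
proof -
  have unc: "|UNIV :: nat set| <o |UNIV :: 'f set|"
    by (rule ordIso_ordLess_trans[OF card_of_nat
          ordLess_ordIso_trans[OF assms(2) ordIso_symmetric[OF assms(3)]]])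
  have "cardSuc |UNIV :: 'f set| =o cardSuc \<kappa>"
    by (rule cardSuc_invar_ordIso[OF card_of_Card_order assms(1), THEN iffD2, OF assms(3)])
  then have suc: "|UNIV :: 'f suc set| =o cardSuc \<kappa>"
    by (rule ordIso_transitive[OF card_of_suc])
  have "|UNIV :: 'f suc set| =o |Field (cardSuc \<kappa>)|"
    by (rule ordIso_transitive[OF suc ordIso_symmetric[OF card_of_Field_ordIso[OF cardSuc_Card_order[OF assms(1)]]]])
  \<comment> \<open>The order \<open>cardSuc \<kappa>\<close> is carried by elements of
    \<open>'c set\<close>, which makes this type large enough for the coordinates.\<close>
  then have "|UNIV :: 'f suc set| \<le>o |UNIV :: 'c set set|"
    by (rule ordIso_ordLeq_trans[OF _ card_of_mono1]) simp
  then obtain \<iota> :: "'f suc \<Rightarrow> 'c set" where "inj \<iota>"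
    using card_of_ordLeq[of "UNIV :: 'f suc set" "UNIV :: 'c set set"] by blast
  from gross_space_of_suc_dimension[OF unc this] obtain E and \<Phi> where
    E: "gross_space (scaleF :: 'f \<Rightarrow> ('c set \<Rightarrow>\<^sub>0 'f) \<Rightarrow> _) |UNIV :: 'f set| E \<Phi>"
    "cdim (scaleF :: 'f \<Rightarrow> ('c set \<Rightarrow>\<^sub>0 'f) \<Rightarrow> _) E =o |UNIV :: 'f suc set|"
    by blast
  have "|UNIV :: 'f set| \<le>o cdim scaleF U" if "\<kappa> \<le>o cdim scaleF U" for U :: "('c set \<Rightarrow>\<^sub>0 'f) set"
    by (rule ordIso_ordLeq_trans[OF assms(3) that])
  then have "gross_space scaleF \<kappa> E \<Phi>"
    using E(1) unfolding gross_space_def by blast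
  moreover have "cdim scaleF E =o cardSuc \<kappa>"
    by (rule ordIso_transitive[OF E(2) suc])
  ultimately show ?thesis
    using F.vector_space_axioms by blast
qed

end
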